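(* Let $(M,g)$ be a Riemannian manifold of dimension $m\ge2$. Let $Y_1,\dots,Y_{m-2},X_1,X_1',X_2,X_2'$ be independent real valued z-KROK random fields on $M$ such that $X_1'$ has the same law as $X_1$ and $X_2'$ has the same law as $X_2$. Let $\mathfrak{Z}:=Y_1^{-1}(0)\cap\dots\cap Y_{m-2}^{-1}(0)$, $Z_i:=X_i^{-1}(0)$ and $Z_i':=(X_i')^{-1}(0)$ for $i=1,2$. Then for all $p\in M$ $$\delta_{Z_1\cap Z_2\cap\mathfrak{Z}}(p)\ \ge\ \sqrt{\delta_{Z_1\cap Z_1'\cap\mathfrak{Z}}(p)\cdot\delta_{Z_2\cap Z_2'\cap\mathfrak{Z}}(p)} .$$
   Context: Random fields. $M$ is a smooth manifold of dimension $m$, possibly non-compact, with Riemannian metric $g$. $C^1(M,\mathbb{R}^k)$ carries the weak Whitney topology; a random field $X$ is a measurable map from a probability space into it; $[Y]$ denotes the law of a random element $Y$. For $f\in C^1(M,\mathbb{R}^k)$ let $J_pf:=\|d_pf^1\wedge\cdots\wedge d_pf^k\|$, with the norm on $\Lambda^kT^*_pM$ induced by $g$ through $\langle v_1\wedge\dots\wedge v_k,w_1\wedge\dots\wedge w_k\rangle=\det(\langle v_i,w_j\rangle)_{i,j}$. A regular conditional probability of $X$ given $X(p)$ is a map $(x,B)\mapsto\mu(p,x)(B)$ ($x\in\mathbb{R}^k$, $B\subset C^1(M,\mathbb{R}^k)$ Borel) such that each $\mu(p,x)$ is a Borel probability measure, $x\mapsto\mu(p,x)(B)$ is Borel, and $\mathbb{P}\{X\in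 B,\,X(p)\in V\}=\int_V\mu(p,x)(B)\,d[X(p)](x)$ for all Borel $B$ and $V\subset\mathbb{R}^k$. $X$ is z-KROK if: (i) $X$ is a random element of $C^1(M,\mathbb{R}^k)$; (ii) almost surely $0$ is a regular value of $X$; (iii) for every $p\in M$ the law of $X(p)$ is absolutely continuous with density $\rho_{X(p)}:\mathbb{R}^k\to[0,+\infty)$; (iv) $(p,x)\mapsto\rho_{X(p)}(x)$ on $M\times\mathbb{R}^k$ is continuous at $(p,0)$ for all $p\in M$; (v) there are regular conditional probabilities $\mu(p,\cdot)$ of $X$ given $X(p)$, $p\in M$, such that the measures $J_p\cdot\mu(p,x)$, $B\mapsto\int_BJ_pf\,d\mu(p,x)(f)$, are finite and $(p,x)\mapsto J_p\cdot\mu(p,x)$, with values in the finite positive Borel measures on $C^1(M,\mathbb{R}^k)$ with the weak topology (tested on bounded continuous functions), is continuous at $(p,0)$ for all $p\in M$. With this $\mu$, write $\mathbb{E}\{\Phi(X)\,|\,X(p)=0\}:=\int\Phi\,d\mu(p,0)$. Density of expected volume. For a field $X$ with zero set $Z=X^{-1}(0)$, $\delta_Z(p):=\delta_X(p):=\mathbb{E}\{J_pX\,|\,X(p)=0\}\,\rho_{X(p)}(0)$. For an intersection of zero sets of independent z-KROK fields $W_1,\dots,W_n$, $\delta_{W_1^{-1}(0)\cap\dots\cap W_n^{-1}(0)}:=\delta_{(W_1,\dots,W_n)}$ is the density of the concatenated field, for which $\rho_{(W_1,\dots,W_n)(p)}(0)=\prod_i\rho_{W_i(p)}(0)$ and the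 conditional law given that all $W_i(p)=0$ is the product of the conditional laws $\mu_i(p,0)$. *)

theory Defs
  imports "HOL-Probability.Probability"
begin

section \<open>Smooth manifolds and Riemannian metrics\<close>

text \<open>\<open>Ck_on n S f\<close> is meant for open \<open>S\<close>: \<open>f\<close> is of class \<open>C^n\<close> on \<open>S\<close>.\<close>

primrec Ck_on ::
  "nat \<Rightarrow> 'a::euclidean_space set \<Rightarrow> ('a \<Rightarrow> 'b::real_normed_vector) \<Rightarrow> bool"
where
  "Ck_on 0 S f \<longleftrightarrow> continuous_on S f"
| "Ck_on (Suc n) S f \<longleftrightarrow>
     (\<forall>x\<in>S. f differentiable (at x)) \<and>
     (\<forall>v. Ck_on n S (\<lambda>x. frechet_derivative f (at x) v))"

definition smooth_on :: "'a::euclidean_space set \<Rightarrow> ('a \<Rightarrow> 'b::real_normed_vector) \<Rightarrow> bool" where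
  "smooth_on S f \<longleftrightarrow> (\<forall>n. Ck_on n S f)"

text \<open>The manifold is the whole type \<open>'p\<close>; its dimension is \<open>CARD('m)\<close>. The second component of
  a chart is only relevant on the domain.\<close>

type_synonym ('p, 'm) chart = "'p set \<times> ('p \<Rightarrow> real^'m)"

definition dom_ch :: "('p, 'm::finite) chart \<Rightarrow> 'p set" where
  "dom_ch c = fst c"

definition map_ch :: "('p, 'm::finite) chart \<Rightarrow> 'p \<Rightarrow> real^'m" where
  "map_ch c = snd c"

definition inv_ch :: "('p, 'm::finite) chart \<Rightarrow> real^'m \<Rightarrow> 'p" where
  "inv_ch c = inv_into (dom_ch c) (map_ch c)"

definition smooth_atlas ::
  "('p::{t2_space,second_countable_topology}, 'm::finite) chart set \<Rightarrow> bool"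
where
  "smooth_atlas A \<longleftrightarrow>
     (\<Union>c\<in>A. dom_ch c) = UNIV \<and>
     (\<forall>c\<in>A. open (dom_ch c) \<and> open (map_ch c ` dom_ch c) \<and>
        homeomorphism (dom_ch c) (map_ch c ` dom_ch c) (map_ch c) (inv_ch c)) \<and>
     (\<forall>c\<in>A. \<forall>d\<in>A. smooth_on (map_ch c ` (dom_ch c \<inter> dom_ch d)) (map_ch d \<circ> inv_ch c))"

text \<open>A Riemannian metric is given by its matrices of components: \<open>G c p\<close> is the Gram matrix at \<open>p\<close>
  of the coordinate vector fields of the chart \<open>c\<close>. The last clause is the tensor transformation
  law, which makes the family one symmetric 2-tensor on the manifold.\<close>

definition riemannian_metric ::
  "('p, 'm::finite) chart set \<Rightarrow> (('p, 'm) chart \<Rightarrow> 'p \<Rightarrow> real^'m^'m) \<Rightarrow> bool"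
where
  "riemannian_metric A G \<longleftrightarrow>
     (\<forall>c\<in>A. smooth_on (map_ch c ` dom_ch c) (G c \<circ> inv_ch c)) \<and>
     (\<forall>c\<in>A. \<forall>p\<in>dom_ch c. transpose (G c p) = G c p \<and> (\<forall>v. v \<noteq> 0 \<longrightarrow> 0 < v \<bullet> (G c p *v v))) \<and>
     (\<forall>c\<in>A. \<forall>d\<in>A. \<forall>p\<in>dom_ch c \<inter> dom_ch d.
        G c p = transpose (jacobian (map_ch d \<circ> inv_ch c) (at (map_ch c p))) ** G d p **
                jacobian (map_ch d \<circ> inv_ch c) (at (map_ch c p)))"

definition riemannian_manifold ::
  "('p::{t2_space,second_countable_topology}, 'm::finite) chart set \<Rightarrow>
   (('p, 'm) chart \<Rightarrow> 'p \<Rightarrow> real^'m^'m) \<Rightarrow> bool"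
where
  "riemannian_manifold A G \<longleftrightarrow> smooth_atlas A \<and> riemannian_metric A G"

section \<open>The space of \<open>C^1\<close> maps\<close>

definition in_chart ::
  "('p, 'm::finite) chart \<Rightarrow> ('p \<Rightarrow> real^'k) \<Rightarrow> real^'m \<Rightarrow> real^'k::finite"
where
  "in_chart c f = f \<circ> inv_ch c"

definition C1_maps :: "('p, 'm::finite) chart set \<Rightarrow> ('p \<Rightarrow> real^'k::finite) set" where
  "C1_maps A = {f. \<forall>c\<in>A. Ck_on 1 (map_ch c ` dom_ch c) (in_chart c f)}"

text \<open>Subbasic sets of the weak Whitney topology: \<open>C^1\<close>-closeness up to \<open>e\<close> on the compact set \<open>K\<close>
  inside the domain of the chart \<open>c\<close>.\<close>

definition whitney_nbhd ::
  "('p, 'm::finite) chart set \<Rightarrow> ('p, 'm) chart \<Rightarrow> 'p set \<Rightarrow> real \<Rightarrow>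
   ('p \<Rightarrow> real^'k::finite) \<Rightarrow> ('p \<Rightarrow> real^'k) set"
where
  "whitney_nbhd A c K e f =
     {h \<in> C1_maps A. \<forall>x \<in> map_ch c ` K.
        norm (in_chart c f x - in_chart c h x) < e \<and>
        onorm (\<lambda>v. frechet_derivative (in_chart c f) (at x) v
                 - frechet_derivative (in_chart c h) (at x) v) < e}"

definition C1_topology ::
  "('p::{t2_space,second_countable_topology}, 'm::finite) chart set \<Rightarrow>
   ('p \<Rightarrow> real^'k::finite) topology"
where
  "C1_topology A = topology_generated_by
     {whitney_nbhd A c K e f | c K e f.
        c \<in> A \<and> compact K \<and> K \<subseteq> dom_ch c \<and> 0 < e \<and> f \<in> C1_maps A}"

definition C1_borel ::
  "('p::{t2_space,second_countable_topology}, 'm::finite) chart set \<Rightarrow>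
   ('p \<Rightarrow> real^'k::finite) measure"
where
  "C1_borel A = sigma (topspace (C1_topology A)) {U. openin (C1_topology A) U}"

text \<open>Row \<open>i\<close> of \<open>diff_in c f p\<close> is the covector \<open>d_p f^i\<close> in the coordinates of the chart \<open>c\<close>.\<close>

definition diff_in ::
  "('p, 'm::finite) chart \<Rightarrow> ('p \<Rightarrow> real^'k::finite) \<Rightarrow> 'p \<Rightarrow> real^'m^'k"
where
  "diff_in c f p = jacobian (in_chart c f) (at (map_ch c p))"

definition regular_value_0 ::
  "('p, 'm::finite) chart set \<Rightarrow> ('p \<Rightarrow> real^'k::finite) \<Rightarrow> bool"
where
  "regular_value_0 A f \<longleftrightarrow>
     (\<forall>c\<in>A. \<forall>p\<in>dom_ch c. f p = 0 \<longrightarrow> surj (\<lambda>v. diff_in c f p *v v))"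

definition chart_at :: "('p, 'm::finite) chart set \<Rightarrow> 'p \<Rightarrow> ('p, 'm) chart" where
  "chart_at A p = (SOME c. c \<in> A \<and> p \<in> dom_ch c)"

text \<open>The inner product which the metric induces on covectors is, in coordinates, the inverse matrix.\<close>

definition cometric ::
  "(('p, 'm::finite) chart \<Rightarrow> 'p \<Rightarrow> real^'m^'m) \<Rightarrow> ('p, 'm) chart \<Rightarrow> 'p \<Rightarrow>
   real^'m \<Rightarrow> real^'m \<Rightarrow> real"
where
  "cometric G c p \<alpha> \<beta> = \<alpha> \<bullet> (matrix_inv (G c p) *v \<beta>)"

text \<open>\<open>jac A G p f\<close> is the norm of \<open>d_p f^1 \<and> \<dots> \<and> d_p f^k\<close>, that is, the square root of the Gram
  determinant of the covectors \<open>d_p f^i\<close>. By the transformation law the value is the same in every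
  chart around \<open>p\<close>.\<close>

definition jac ::
  "('p, 'm::finite) chart set \<Rightarrow> (('p, 'm) chart \<Rightarrow> 'p \<Rightarrow> real^'m^'m) \<Rightarrow>
   'p \<Rightarrow> ('p \<Rightarrow> real^'k::finite) \<Rightarrow> real"
where
  "jac A G p f = sqrt (det ((\<chi> i j. cometric G (chart_at A p) p
      (diff_in (chart_at A p) f p $ i) (diff_in (chart_at A p) f p $ j)) :: real^'k^'k))"

section \<open>z-KROK random fields\<close>

text \<open>A random field together with the densities \<open>rf_dens X p\<close> of \<open>X(p)\<close> and the conditional laws
  \<open>rf_cond X p x\<close> of \<open>X\<close> given \<open>X(p) = x\<close> that witness the z-KROK property.\<close>

record ('w, 'p, 'k) random_field =
  rf_map :: "'w \<Rightarrow> 'p \<Rightarrow> real^'k"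
  rf_dens :: "'p \<Rightarrow> real^'k \<Rightarrow> real"
  rf_cond :: "'p \<Rightarrow> real^'k \<Rightarrow> ('p \<Rightarrow> real^'k) measure"

definition regular_cond_prob ::
  "('p::{t2_space,second_countable_topology}, 'm::finite) chart set \<Rightarrow> 'w measure \<Rightarrow>
   ('w \<Rightarrow> 'p \<Rightarrow> real^'k::finite) \<Rightarrow> 'p \<Rightarrow> (real^'k \<Rightarrow> ('p \<Rightarrow> real^'k) measure) \<Rightarrow> bool"
where
  "regular_cond_prob A P X p \<mu> \<longleftrightarrow>
     (\<forall>x. prob_space (\<mu> x) \<and> sets (\<mu> x) = sets (C1_borel A)) \<and>
     (\<forall>B \<in> sets (C1_borel A). (\<lambda>x. emeasure (\<mu> x) B) \<in> borel_measurable borel) \<and>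
     (\<forall>B \<in> sets (C1_borel A). \<forall>V \<in> sets borel.
        emeasure P {\<omega> \<in> space P. X \<omega> \<in> B \<and> X \<omega> p \<in> V} =
        (\<integral>\<^sup>+ x\<in>V. emeasure (\<mu> x) B \<partial>distr P borel (\<lambda>\<omega>. X \<omega> p)))"

definition weighted_cond ::
  "('p, 'm::finite) chart set \<Rightarrow> (('p, 'm) chart \<Rightarrow> 'p \<Rightarrow> real^'m^'m) \<Rightarrow>
   ('p \<Rightarrow> real^'k::finite \<Rightarrow> ('p \<Rightarrow> real^'k) measure) \<Rightarrow> 'p \<Rightarrow> real^'k \<Rightarrow> ('p \<Rightarrow> real^'k) measure"
where
  "weighted_cond A G \<mu> p x = density (\<mu> p x) (\<lambda>f. ennreal (jac A G p f))"

definition z_KROK ::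
  "('p::{t2_space,second_countable_topology}, 'm::finite) chart set \<Rightarrow>
   (('p, 'm) chart \<Rightarrow> 'p \<Rightarrow> real^'m^'m) \<Rightarrow> 'w measure \<Rightarrow> ('w, 'p, 'k::finite) random_field \<Rightarrow> bool"
where
  "z_KROK A G P X \<longleftrightarrow>
     rf_map X \<in> P \<rightarrow>\<^sub>M C1_borel A \<and>
     (AE \<omega> in P. regular_value_0 A (rf_map X \<omega>)) \<and>
     (\<forall>p. (\<forall>x. 0 \<le> rf_dens X p x) \<and>
        distributed P lborel (\<lambda>\<omega>. rf_map X \<omega> p) (\<lambda>x. ennreal (rf_dens X p x))) \<and>
     (\<forall>p. isCont (\<lambda>(q, x). rf_dens X q x) (p, 0)) \<and>
     (\<forall>p. regular_cond_prob A P (rf_map X) p (rf_cond X p)) \<and>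
     (\<forall>p x. finite_measure (weighted_cond A G (rf_cond X) p x)) \<and>
     (\<forall>\<Phi> :: ('p \<Rightarrow> real^'k) \<Rightarrow> real.
        continuous_map (C1_topology A) euclideanreal \<Phi> \<and>
        bounded (\<Phi> ` topspace (C1_topology A)) \<longrightarrow>
        (\<forall>p. isCont (\<lambda>(q, x). \<integral>f. \<Phi> f \<partial>weighted_cond A G (rf_cond X) q x) (p, 0)))"

definition vol_density ::
  "('p, 'm::finite) chart set \<Rightarrow> (('p, 'm) chart \<Rightarrow> 'p \<Rightarrow> real^'m^'m) \<Rightarrow>
   ('w, 'p, 'k::finite) random_field \<Rightarrow> 'p \<Rightarrow> real"
where
  "vol_density A G X p = (\<integral>f. jac A G p f \<partial>rf_cond X p 0) * rf_dens X p 0"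

section \<open>Concatenation of independent real valued fields\<close>

text \<open>A list of \<open>CARD('k)\<close> objects seen as a family indexed by \<open>'k\<close>: \<open>to_nat_on UNIV\<close> is a bijection
  from \<open>'k\<close> onto \<open>{..<CARD('k)}\<close>.\<close>

definition nth_at :: "'a list \<Rightarrow> 'k::finite \<Rightarrow> 'a" where
  "nth_at xs i = xs ! to_nat_on (UNIV :: 'k set) i"

definition concat_maps :: "('k::finite \<Rightarrow> 'p \<Rightarrow> real^1) \<Rightarrow> 'p \<Rightarrow> real^'k" where
  "concat_maps f p = (\<chi> i. f i p $ 1)"

text \<open>The fields in \<open>Ws\<close> are meant to be independent and \<open>CARD('k)\<close> many. Then the density of the
  concatenated field at \<open>p\<close> is the product of the densities, and its conditional law is the product
  of the conditional laws, transported along the bijection \<open>concat_maps\<close> (\<open>embed_measure\<close> is the image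
  measure under an injection, on the image \<open>\<sigma>\<close>-algebra).\<close>

definition concat_fields ::
  "('w, 'p, 1) random_field list \<Rightarrow> ('w, 'p, 'k::finite) random_field"
where
  "concat_fields Ws =
     \<lparr> rf_map = (\<lambda>\<omega>. concat_maps (\<lambda>i. rf_map (nth_at Ws i) \<omega>)),
       rf_dens = (\<lambda>p x. \<Prod>i\<in>UNIV. rf_dens (nth_at Ws i) p (vec (x $ i))),
       rf_cond = (\<lambda>p x. embed_measure
         (\<Pi>\<^sub>M i\<in>UNIV. rf_cond (nth_at Ws i) p (vec (x $ i))) concat_maps) \<rparr>"

text \<open>The density of the intersection of the zero sets of the fields in \<open>Ws\<close>, whose number is the
  dimension of the manifold.\<close>

definition vol_density_inter ::
  "('p, 'm::finite) chart set \<Rightarrow> (('p, 'm) chart \<Rightarrow> 'p \<Rightarrow> real^'m^'m) \<Rightarrow>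
   ('w, 'p, 1) random_field list \<Rightarrow> 'p \<Rightarrow> real"
where
  "vol_density_inter A G Ws =
     vol_density A G (concat_fields Ws :: ('w, 'p, 'm) random_field)"

end

theory Submission
  imports Defs
begin

text \<open>
  In top degree the Jacobian of the concatenated field is, up to the factor \<open>sqrt (det G\<^sup>-\<^sup>1)\<close>,
  the modulus of the determinant of the differentials at the point, read in a chart. So the density
  is a constant times \<open>E \<bar>det (a\<^sub>1, \<dots>, a\<^sub>m)\<bar>\<close> for independent random covectors \<open>a\<^sub>i\<close>, which is a mixed
  volume of zonoids, and the claim is the Alexandrov--Fenchel inequality for zonoids. By approximation
  the covectors may be supposed to take finitely many values. Then the inequality follows by induction
  on the number of non-constant covectors among those other than the two special ones.
  When all of these are constant, \<open>\<bar>det\<bar>\<close> is a planar form and the claim follows from the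
  conditional negativity of the Euclidean distance kernel. For the induction step, fixing the value of
  one more covector gives matrices for which the inequality is known, and these inequalities combine
  to a Bochner-type inequality for the original matrix, which forces each of its eigenvalues (in the
  appropriate inner product) to be at most 0 or at least 1. By the Perron--Frobenius argument only the
  trivial eigenvalue 1 is positive.

  That the conditional laws of two fields with the same law can be exchanged follows from the
  continuity at 0 in the z-KROK property, unless the density of the value vanishes at 0, and in that
  case the right-hand side is 0.
\<close>

section \<open>Conditional negativity of planar distances\<close>

text \<open>A reverse Cauchy-Schwarz inequality such as this one holds for a symmetric form that is
  nonpositive on some hyperplane, and it is in this shape that hyperbolicity is proved. The obstacle
  is that such forms are not closed under sums, so averaging over the value of one more covector
  could destroy the property. What prevents this is the symmetry of the absolute determinant in all
  its slots. Let \<open>M\<close> be the matrix in which one further slot carries the weight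
  \<open>g\<close>, and \<open>N i\<close> the matrix in which that slot is fixed at
  \<open>i\<close>. Then \<open>M\<close> is the average of the \<open>N i\<close> with weights
  \<open>g i\<close>, and row \<open>i\<close> of \<open>M\<close> applied to \<open>p\<close> is
  the value of the form \<open>N i\<close> at \<open>p\<close> and \<open>g\<close>. So the
  hyperbolicity of each \<open>N i\<close>, used against the single vector \<open>g\<close>, bounds
  the form of \<open>M\<close> by the square of the operator of \<open>M\<close>. A spectrum
  avoiding the interval between 0 and 1 still allows several eigenvalues from 1 upwards. Excluding
  them takes a connected graph, which is why the discrete inequality is proved for strictly positive
  weights on a spanning set and reaches general weights by continuity.\<close>

definition bil :: "'v set \<Rightarrow> ('v \<Rightarrow> 'v \<Rightarrow> real) \<Rightarrow> ('v \<Rightarrow> real) \<Rightarrow> ('v \<Rightarrow> real) \<Rightarrow> real" where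
  "bil V M x y = (\<Sum>v\<in>V. \<Sum>w\<in>V. M v w * x v * y w)"

lemma bil_commute:
  assumes "\<And>v w. v \<in> V \<Longrightarrow> w \<in> V \<Longrightarrow> M v w = M w v"
  shows "bil V M x y = bil V M y x"
  unfolding bil_def by (subst sum.swap) (auto intro!: sum.cong simp: assms mult_ac)

lemma bil_add_left: "bil V M (\<lambda>v. x v + c * y v) z = bil V M x z + c * bil V M y z"
  by (simp add: bil_def sum_distrib_left sum.distrib[symmetric] algebra_simps)

lemma bil_add_right: "bil V M z (\<lambda>v. x v + c * y v) = bil V M z x + c * bil V M z y"
  by (simp add: bil_def sum_distrib_left sum.distrib[symmetric] algebra_simps)

lemma bil_eq: "bil V M x y = (\<Sum>v\<in>V. x v * (\<Sum>w\<in>V. M v w * y w))"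
  by (simp add: bil_def sum_distrib_left algebra_simps)

text \<open>If the form had a positive definite plane, that plane would meet the hyperplane.\<close>

lemma hyperbolic_from_hyperplane:
  assumes sym: "\<And>v w. v \<in> V \<Longrightarrow> w \<in> V \<Longrightarrow> M v w = M w v"
    and neg: "\<And>x. (\<Sum>v\<in>V. l v * x v) = 0 \<Longrightarrow> bil V M x x \<le> 0"
    and y: "0 \<le> bil V M y y"
  shows "bil V M x x * bil V M y y \<le> (bil V M x y)\<^sup>2"
proof (cases "bil V M y y = 0")
  case False
  with y have pos: "bil V M y y > 0" by simp
  define L where "L = (\<lambda>x. \<Sum>v\<in>V. l v * x v)"
  have "L y \<noteq> 0" using neg[of y] pos by (auto simp: L_def)
  define t where "t = - L x / L y"
  define z where "z = (\<lambda>v. x v + t * y v)"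
  have "L z = L x + t * L y"
    by (simp add: L_def z_def sum_distrib_left sum.distrib[symmetric] algebra_simps)
  then have "L z = 0" using \<open>L y \<noteq> 0\<close> by (simp add: t_def)
  then have "bil V M z z \<le> 0" using neg by (simp add: L_def)
  moreover have "bil V M z z = bil V M x x + 2 * t * bil V M x y + t\<^sup>2 * bil V M y y"
    unfolding z_def bil_add_left bil_add_right
    using bil_commute[of V M y x, OF sym] by (simp add: algebra_simps power2_eq_square)
  ultimately have "bil V M y y * (bil V M x x + 2 * t * bil V M x y + t\<^sup>2 * bil V M y y) \<le> 0"
    using pos by (simp add: mult_le_0_iff)
  \<comment> \<open>After multiplication by \<open>bil V M y y\<close>, completing the square leaves
    the discriminant inequality.\<close>
  moreover have "0 \<le> (bil V M y y * t + bil V M x y)\<^sup>2" by simp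
  ultimately show ?thesis by (simp add: algebra_simps power2_eq_square)
qed simp

text \<open>Up to terms that the condition kills, the kernel is \<open>-2 min\<close>, and \<open>min (s v) (s w) - R\<close> is the
  inner product in \<open>L\<^sup>2\<close> of the indicators of \<open>{R..<s v}\<close> and \<open>{R..<s w}\<close>.\<close>

lemma abs_diff_cond_neg:
  fixes s c :: "'v \<Rightarrow> real"
  assumes "finite V" "(\<Sum>v\<in>V. c v) = 0"
  shows "(\<Sum>v\<in>V. \<Sum>w\<in>V. c v * c w * \<bar>s v - s w\<bar>) \<le> 0"
proof -
  obtain R where R: "\<And>v. v \<in> V \<Longrightarrow> R \<le> s v"
    using assms(1) by (meson finite_imageI bdd_below_finite bdd_below.unfold image_eqI)
  define I :: "'v \<Rightarrow> real \<Rightarrow> real" where "I = (\<lambda>v. indicator {R..<s v})"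
  have int: "integrable lborel (\<lambda>\<tau>. c v * c w * (I v \<tau> * I w \<tau>))"
    and val: "(\<integral>\<tau>. c v * c w * (I v \<tau> * I w \<tau>) \<partial>lborel) = c v * c w * (min (s v) (s w) - R)"
    if "v \<in> V" "w \<in> V" for v w
  proof -
    have *: "I v \<tau> * I w \<tau> = indicator {R..<min (s v) (s w)} \<tau>" for \<tau>
      by (auto simp: I_def indicator_def)
    show "integrable lborel (\<lambda>\<tau>. c v * c w * (I v \<tau> * I w \<tau>))"
      unfolding * using R[OF that(1)] R[OF that(2)] by (intro integrable_mult_right integrable_real_indicator) auto
    show "(\<integral>\<tau>. c v * c w * (I v \<tau> * I w \<tau>) \<partial>lborel) = c v * c w * (min (s v) (s w) - R)"
      unfolding * using R[OF that(1)] R[OF that(2)] by simp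
  qed
  have "0 \<le> (\<integral>\<tau>. (\<Sum>v\<in>V. c v * I v \<tau>)\<^sup>2 \<partial>lborel)" by simp
  also have "\<dots> = (\<integral>\<tau>. (\<Sum>v\<in>V. \<Sum>w\<in>V. c v * c w * (I v \<tau> * I w \<tau>)) \<partial>lborel)"
    by (simp add: power2_eq_square sum_product algebra_simps)
  also have "\<dots> = (\<Sum>v\<in>V. \<Sum>w\<in>V. c v * c w * (min (s v) (s w) - R))"
  proof -
    have "(\<integral>\<tau>. (\<Sum>v\<in>V. \<Sum>w\<in>V. c v * c w * (I v \<tau> * I w \<tau>)) \<partial>lborel)
        = (\<Sum>v\<in>V. \<integral>\<tau>. (\<Sum>w\<in>V. c v * c w * (I v \<tau> * I w \<tau>)) \<partial>lborel)"
      by (intro Bochner_Integration.integral_sum Bochner_Integration.integrable_sum int)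
    also have "\<dots> = (\<Sum>v\<in>V. \<Sum>w\<in>V. \<integral>\<tau>. c v * c w * (I v \<tau> * I w \<tau>) \<partial>lborel)"
      by (intro sum.cong refl Bochner_Integration.integral_sum int)
    also have "\<dots> = (\<Sum>v\<in>V. \<Sum>w\<in>V. c v * c w * (min (s v) (s w) - R))"
      by (intro sum.cong refl val)
    finally show ?thesis .
  qed
  finally have pos: "0 \<le> (\<Sum>v\<in>V. \<Sum>w\<in>V. c v * c w * (min (s v) (s w) - R))" .
  have "c v * c w * \<bar>s v - s w\<bar> = (c v * (s v - R)) * c w + c v * (c w * (s w - R)) - 2 * (c v * c w * (min (s v) (s w) - R))" for v w
    by (simp add: min_def abs_if algebra_simps)
  then have "(\<Sum>v\<in>V. \<Sum>w\<in>V. c v * c w * \<bar>s v - s w\<bar>)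
     = (\<Sum>v\<in>V. \<Sum>w\<in>V. (c v * (s v - R)) * c w) + (\<Sum>v\<in>V. \<Sum>w\<in>V. c v * (c w * (s w - R)))
        - 2 * (\<Sum>v\<in>V. \<Sum>w\<in>V. c v * c w * (min (s v) (s w) - R))"
    by (simp add: sum.distrib sum_subtractf sum_distrib_left)
  also have "\<dots> = - 2 * (\<Sum>v\<in>V. \<Sum>w\<in>V. c v * c w * (min (s v) (s w) - R))"
    by (simp add: sum_product[symmetric] assms)
  finally show ?thesis using pos by simp
qed

section \<open>From the line to the plane by averaging over directions\<close>

lemma abs_sin_has_integral:
  assumes "\<alpha> \<in> {0..pi}"
  shows "((\<lambda>t. \<bar>sin (\<alpha> - t)\<bar>) has_integral 2) {0..pi}"
proof -
  have "((\<lambda>t. sin (\<alpha> - t)) has_integral (cos (\<alpha> - \<alpha>) - cos (\<alpha> - 0))) {0..\<alpha>}"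
    using assms by (intro fundamental_theorem_of_calculus)
      (auto intro!: derivative_eq_intros simp flip: has_real_derivative_iff_has_vector_derivative)
  then have 1: "((\<lambda>t. \<bar>sin (\<alpha> - t)\<bar>) has_integral (1 - cos \<alpha>)) {0..\<alpha>}"
  proof (rule_tac has_integral_eq[rotated])
    fix t assume t: "t \<in> {0..\<alpha>}"
    then have "0 \<le> sin (\<alpha> - t)" using assms by (intro sin_ge_zero) auto
    then show "sin (\<alpha> - t) = \<bar>sin (\<alpha> - t)\<bar>" by simp
  qed simp
  have "((\<lambda>t. - sin (\<alpha> - t)) has_integral (- cos (\<alpha> - pi) - (- cos (\<alpha> - \<alpha>)))) {\<alpha>..pi}"
    using assms by (intro fundamental_theorem_of_calculus)
      (auto intro!: derivative_eq_intros simp flip: has_real_derivative_iff_has_vector_derivative)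
  then have 2: "((\<lambda>t. \<bar>sin (\<alpha> - t)\<bar>) has_integral (1 + cos \<alpha>)) {\<alpha>..pi}"
  proof (rule_tac has_integral_eq[rotated])
    fix t assume t: "t \<in> {\<alpha>..pi}"
    then have "0 \<le> sin (t - \<alpha>)" using assms by (intro sin_ge_zero) auto
    then show "- sin (\<alpha> - t) = \<bar>sin (\<alpha> - t)\<bar>"
      using sin_minus[of "\<alpha> - t"] by simp
  qed (simp add: cos_diff add.commute)
  show ?thesis
    using has_integral_combine[OF _ _ 1 2] assms by simp
qed

text \<open>A Crofton formula: twice the length of a planar vector is the integral of the lengths of
  its projections over a half turn of directions.\<close>

lemma norm_has_integral_abs_Im:
  "((\<lambda>t. \<bar>Im (z * cis (- t))\<bar>) has_integral 2 * cmod z) {0..pi}"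
proof -
  have z: "z = rcis (cmod z) (Arg z)" by (simp add: rcis_cmod_Arg)
  \<comment> \<open>A shift by \<open>pi\<close> only changes the sign of the sine, and it brings
    the angle into the interval on which the integral was computed.\<close>
  define \<alpha> where "\<alpha> = (if Arg z < 0 then Arg z + pi else Arg z)"
  have \<alpha>: "\<alpha> \<in> {0..pi}" using Arg_bounded[of z] by (auto simp: \<alpha>_def)
  have "\<bar>Im (z * cis (- t))\<bar> = cmod z * \<bar>sin (\<alpha> - t)\<bar>" for t
  proof -
    have "z * cis (- t) = rcis (cmod z) (Arg z - t)"
      by (subst z) (simp add: rcis_def cis_mult mult.assoc)
    then have "\<bar>Im (z * cis (- t))\<bar> = cmod z * \<bar>sin (Arg z - t)\<bar>"
      by (simp add: abs_mult)
    moreover have "sin (Arg z + pi - t) = - sin (Arg z - t)"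
      using sin_periodic_pi[of "Arg z - t"] by (simp add: algebra_simps)
    ultimately show ?thesis by (simp add: \<alpha>_def)
  qed
  then show ?thesis
    using has_integral_mult_right[OF abs_sin_has_integral[OF \<alpha>], of "cmod z"] by (simp add: mult.commute)
qed

text \<open>Every projection of the points to a line gives a nonpositive double sum, hence so does
  the integral over all directions.\<close>

lemma cmod_diff_cond_neg:
  fixes z :: "'v \<Rightarrow> complex" and c :: "'v \<Rightarrow> real"
  assumes "finite V" "(\<Sum>v\<in>V. c v) = 0"
  shows "(\<Sum>v\<in>V. \<Sum>w\<in>V. c v * c w * cmod (z v - z w)) \<le> 0"
proof -
  have "((\<lambda>t. \<Sum>v\<in>V. \<Sum>w\<in>V. c v * c w * \<bar>Im ((z v - z w) * cis (- t))\<bar>) has_integral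
     (\<Sum>v\<in>V. \<Sum>w\<in>V. c v * c w * (2 * cmod (z v - z w)))) {0..pi}"
    using assms(1) by (intro has_integral_sum has_integral_mult_right norm_has_integral_abs_Im) auto
  moreover have "(\<Sum>v\<in>V. \<Sum>w\<in>V. c v * c w * \<bar>Im ((z v - z w) * cis (- t))\<bar>) \<le> 0" for t
    using abs_diff_cond_neg[OF assms, of "\<lambda>v. Im (z v * cis (- t))"] by (simp add: algebra_simps)
  ultimately have "(\<Sum>v\<in>V. \<Sum>w\<in>V. c v * c w * (2 * cmod (z v - z w))) \<le> 0"
    using has_integral_le[OF _ has_integral_0] by blast
  moreover have "(\<Sum>v\<in>V. \<Sum>w\<in>V. c v * c w * (2 * cmod (z v - z w)))
     = 2 * (\<Sum>v\<in>V. \<Sum>w\<in>V. c v * c w * cmod (z v - z w))"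
    by (simp add: sum_distrib_left algebra_simps)
  ultimately show ?thesis by simp
qed

text \<open>Squaring unit vectors doubles angles: \<open>\<bar>sin (s - t)\<bar>\<close> is half of a chord of the unit circle.\<close>

lemma abs_Im_cnj_mult: "\<bar>Im (cnj z * w)\<bar> = cmod z * cmod w * (cmod ((sgn z)\<^sup>2 - (sgn w)\<^sup>2) / 2)"
proof (cases "z = 0 \<or> w = 0")
  case False
  define s t where "s = sgn z" and "t = sgn w"
  have n: "cmod s = 1" "cmod t = 1" using False by (auto simp: s_def t_def norm_sgn)
  have zw: "z = of_real (cmod z) * s" "w = of_real (cmod w) * t"
    using False by (auto simp: s_def t_def sgn_eq)
  have "cmod (s\<^sup>2 - t\<^sup>2) = cmod (cnj s * cnj t * (s\<^sup>2 - t\<^sup>2))" by (simp add: norm_mult n)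
  also have "cnj s * cnj t * (s\<^sup>2 - t\<^sup>2) = (cnj s * s) * (s * cnj t) - (cnj t * t) * (t * cnj s)"
    by (simp add: algebra_simps power2_eq_square)
  also have "\<dots> = s * cnj t - t * cnj s"
    using n complex_norm_square[of s] complex_norm_square[of t] by (simp add: mult.commute)
  also have "\<dots> = - 2 * \<i> * of_real (Im (cnj s * t))"
    by (simp add: complex_eq_iff)
  finally have "cmod (s\<^sup>2 - t\<^sup>2) = 2 * \<bar>Im (cnj s * t)\<bar>"
    by (simp only: norm_mult norm_of_real norm_minus_cancel norm_ii norm_numeral)
  moreover have "cnj z * w = of_real (cmod z * cmod w) * (cnj s * t)"
    by (subst zw(1), subst zw(2)) simp
  then have "\<bar>Im (cnj z * w)\<bar> = cmod z * cmod w * \<bar>Im (cnj s * t)\<bar>"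
    by (simp only: Im_complex_of_real times_complex.simps Re_complex_of_real) (simp add: abs_mult)
  ultimately show ?thesis by (simp add: s_def t_def)
qed auto

text \<open>Once the moduli are absorbed into the coefficients \<open>cmod (z v) * x v\<close>, the
  kernel is half the distance between squared unit vectors. The hyperplane is the one on which these
  coefficients sum to zero.\<close>

lemma planar_hyperbolic:
  fixes z :: "'v \<Rightarrow> complex"
  assumes "finite V" "(\<Sum>v\<in>V. cmod (z v) * x v) = 0"
  shows "bil V (\<lambda>v w. \<bar>Im (cnj (z v) * z w)\<bar>) x x \<le> 0"
proof -
  have "(\<Sum>v\<in>V. \<Sum>w\<in>V. (cmod (z v) * x v) * (cmod (z w) * x w) * cmod ((sgn (z v))\<^sup>2 - (sgn (z w))\<^sup>2)) \<le> 0"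
    by (rule cmod_diff_cond_neg[OF assms])
  moreover have "bil V (\<lambda>v w. \<bar>Im (cnj (z v) * z w)\<bar>) x x =
    (\<Sum>v\<in>V. \<Sum>w\<in>V. (cmod (z v) * x v) * (cmod (z w) * x w) * cmod ((sgn (z v))\<^sup>2 - (sgn (z w))\<^sup>2)) / 2"
    unfolding bil_def abs_Im_cnj_mult by (simp add: sum_divide_distrib algebra_simps)
  ultimately show ?thesis by simp
qed

section \<open>A local-to-global principle for hyperbolic matrices\<close>

lemma bil_scale: "bil V M (\<lambda>v. c * x v) (\<lambda>v. d * y v) = c * d * bil V M x y"
  by (simp add: bil_def sum_distrib_left algebra_simps)

text \<open>The weighted unit sphere in the hyperplane is compact, and homogeneity carries the bound
  from it to the whole hyperplane. The vector \<open>x\<close> shows that the sphere is nonempty and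
  the maximum positive.\<close>

lemma rayleigh_maximizer:
  fixes M :: "'v \<Rightarrow> 'v \<Rightarrow> real" and e l :: "'v \<Rightarrow> real"
  assumes fin: "finite V" and e: "\<And>v. v \<in> V \<Longrightarrow> e v > 0"
    and x: "(\<Sum>v\<in>V. l v * x v) = 0" "bil V M x x > 0"
  obtains z where "(\<Sum>v\<in>V. l v * z v) = 0" "(\<Sum>v\<in>V. e v * (z v)\<^sup>2) = 1" "bil V M z z > 0"
    "\<And>y. (\<Sum>v\<in>V. l v * y v) = 0 \<Longrightarrow> bil V M y y \<le> bil V M z z * (\<Sum>v\<in>V. e v * (y v)\<^sup>2)"
proof -
  define E where "E = (\<lambda>y. \<Sum>v\<in>V. e v * (y v)\<^sup>2)"
  \<comment> \<open>The vectors are functions on the whole type, so their values off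
    \<open>V\<close> are pinned to 0; on \<open>V\<close> the bounds are those that
    \<open>E y = 1\<close> forces. The box is compact as a product of compact sets.\<close>
  define B :: "('v \<Rightarrow> real) set" where "B = PiE UNIV (\<lambda>v. if v \<in> V then {- sqrt (1 / e v)..sqrt (1 / e v)} else {0})"
  define K where "K = {y \<in> B. E y = 1 \<and> (\<Sum>v\<in>V. l v * y v) = 0}"
  have cont: "continuous_on S (\<lambda>y :: 'v \<Rightarrow> real. y v)" for S v
    by (rule continuous_on_subset[OF continuous_on_product_coordinates]) simp
  have "compactin (product_topology (\<lambda>i. euclidean) UNIV) B"
    unfolding B_def compactin_PiE by auto
  then have "compact B" by (simp add: euclidean_product_topology)
  moreover have "closed {y. E y = 1 \<and> (\<Sum>v\<in>V. l v * y v) = 0}"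
    unfolding E_def by (intro closed_Collect_conj closed_Collect_eq continuous_intros cont)
  ultimately have K: "compact K"
    unfolding K_def by (metis Collect_conj_eq Collect_mem_eq compact_Int_closed)
  have scale: "\<exists>y'\<in>K. \<exists>c. c > 0 \<and> c * c = E y \<and> bil V M y y = c * c * bil V M y' y'"
    if y: "(\<Sum>v\<in>V. l v * y v) = 0" "bil V M y y \<noteq> 0" for y
  proof -
    have "E y \<noteq> 0"
    proof
      assume "E y = 0"
      then have "\<forall>v\<in>V. e v * (y v)\<^sup>2 = 0"
        unfolding E_def using e by (subst (asm) sum_nonneg_eq_0_iff[OF fin]) (auto simp: less_imp_le)
      then have "\<forall>v\<in>V. y v = 0" using e by force
      then show False using y(2) by (simp add: bil_def)
    qed
    moreover have "E y \<ge> 0" unfolding E_def using e by (intro sum_nonneg) (auto simp: less_imp_le)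
    ultimately have pos: "E y > 0" by simp
    define c where "c = sqrt (E y)"
    have c: "c > 0" "c * c = E y" using pos by (auto simp: c_def)
    define y' where "y' = (\<lambda>v. if v \<in> V then y v / c else 0)"
    have E1: "E y' = 1"
    proof -
      have "E y' = E y / c\<^sup>2" unfolding E_def sum_divide_distrib by (intro sum.cong) (auto simp: y'_def power_divide)
      then show ?thesis using c pos by (simp add: power2_eq_square)
    qed
    have l: "(\<Sum>v\<in>V. l v * y' v) = 0"
    proof -
      have "(\<Sum>v\<in>V. l v * y' v) = (\<Sum>v\<in>V. l v * y v) / c"
        unfolding sum_divide_distrib by (intro sum.cong) (auto simp: y'_def)
      then show ?thesis using y by simp
    qed
    have "y' v \<in> {- sqrt (1 / e v)..sqrt (1 / e v)}" if "v \<in> V" for v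
    proof -
      have "e v * (y' v)\<^sup>2 \<le> E y'"
        unfolding E_def using that e fin by (intro member_le_sum) (auto simp: less_imp_le)
      then have "(y' v)\<^sup>2 \<le> 1 / e v" using e[OF that] E1 by (simp add: field_simps)
      then have "\<bar>y' v\<bar> \<le> sqrt (1 / e v)" using real_le_rsqrt by (metis power2_abs)
      then show ?thesis by auto
    qed
    then have "y' \<in> B" unfolding B_def by (auto simp: PiE_def y'_def)
    then have "y' \<in> K" unfolding K_def using E1 l by simp
    moreover have "bil V M y y = c * c * bil V M y' y'"
    proof -
      have "bil V M y y = bil V M (\<lambda>v. c * y' v) (\<lambda>v. c * y' v)"
        using c unfolding bil_def by (intro sum.cong refl) (auto simp: y'_def)
      then show ?thesis by (simp add: bil_scale)
    qed
    ultimately show ?thesis using c by blast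
  qed
  obtain x' c where x': "x' \<in> K" "c > 0" "bil V M x x = c * c * bil V M x' x'"
    using scale[OF x(1)] x(2) by auto
  have "continuous_on K (\<lambda>y. bil V M y y)"
    unfolding bil_def by (intro continuous_intros cont)
  then obtain z where z: "z \<in> K" "\<forall>y\<in>K. bil V M y y \<le> bil V M z z"
    using continuous_attains_sup[OF K] x'(1) by blast
  have "bil V M x' x' > 0" using x(2) x' by (simp add: zero_less_mult_iff)
  then have pos: "bil V M z z > 0" using z x'(1) by force
  show thesis
  proof
    show "(\<Sum>v\<in>V. l v * z v) = 0" "(\<Sum>v\<in>V. e v * (z v)\<^sup>2) = 1" using z(1) by (auto simp: K_def E_def)
    show "bil V M z z > 0" by fact
    fix y assume y: "(\<Sum>v\<in>V. l v * y v) = 0"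
    have E: "E y \<ge> 0" unfolding E_def using e by (intro sum_nonneg) (auto simp: less_imp_le)
    show "bil V M y y \<le> bil V M z z * (\<Sum>v\<in>V. e v * (y v)\<^sup>2)"
    proof (cases "bil V M y y = 0")
      case True
      then show ?thesis using pos E by (simp add: E_def)
    next
      case False
      then obtain y' c where "y' \<in> K" "c * c = E y" "bil V M y y = c * c * bil V M y' y'"
        using scale[OF y] by blast
      then show ?thesis using z(2) E by (simp add: E_def mult.commute mult_right_mono)
    qed
  qed
qed

text \<open>The first-order condition at a maximum. In the concave case the witness is the vertex of
  the parabola.\<close>

lemma linear_term_zero:
  fixes a b :: real
  assumes "\<And>t. a * t + b * t\<^sup>2 \<le> 0"
  shows "a = 0"
proof (rule ccontr)
  assume "a \<noteq> 0"
  show False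
  proof (cases "b \<ge> 0")
    case True
    have "a * a + b * a\<^sup>2 > 0" using \<open>a \<noteq> 0\<close> True
      by (metis add_pos_nonneg mult_nonneg_nonneg not_real_square_gt_zero zero_le_power2)
    with assms[of a] show False by simp
  next
    case False
    have "a * (a / (- 2 * b)) + b * (a / (- 2 * b))\<^sup>2 = a\<^sup>2 / (- 4 * b)"
      using False by (simp add: field_simps power2_eq_square)
    moreover have "a\<^sup>2 / (- 4 * b) > 0" using False \<open>a \<noteq> 0\<close> by (intro divide_pos_pos) auto
    ultimately show False using assms[of "a / (- 2 * b)"] by simp
  qed
qed

text \<open>With \<open>e v = d v / h v\<close> as weights of the inner product, the assumption \<open>bochner\<close> reads
  \<open>\<langle>x, N x\<rangle> \<le> \<langle>N x, N x\<rangle>\<close> for the self-adjoint operator \<open>N\<close> with matrix \<open>M v w / e v\<close>, and \<open>N h = h\<close>.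
  A maximizer of the Rayleigh quotient on the complement of \<open>h\<close> is an eigenvector, with
  an eigenvalue \<open>\<ge> 1\<close> if the conclusion fails; the maximum principle excludes this.\<close>

lemma local_global_active:
  fixes V :: "'v set" and M :: "'v \<Rightarrow> 'v \<Rightarrow> real" and h :: "'v \<Rightarrow> real"
  defines "d \<equiv> \<lambda>v. \<Sum>w\<in>V. M v w * h w"
  assumes fin: "finite V"
    and sym: "\<And>v w. v \<in> V \<Longrightarrow> w \<in> V \<Longrightarrow> M v w = M w v"
    and nonneg: "\<And>v w. v \<in> V \<Longrightarrow> w \<in> V \<Longrightarrow> M v w \<ge> 0"
    and h: "\<And>v. v \<in> V \<Longrightarrow> h v > 0"
    and d: "\<And>v. v \<in> V \<Longrightarrow> d v > 0"
    and bochner: "\<And>x. bil V M x x \<le> (\<Sum>v\<in>V. h v * (\<Sum>w\<in>V. M v w * x w)\<^sup>2 / d v)"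
    and irred: "\<And>v w. v \<in> V \<Longrightarrow> w \<in> V \<Longrightarrow> M v w > 0 \<or> (\<exists>u\<in>V. M v u > 0 \<and> M u w > 0)"
    and x: "(\<Sum>v\<in>V. d v * x v) = 0"
  shows "bil V M x x \<le> 0"
proof (rule ccontr)
  assume "\<not> ?thesis"
  then have "bil V M x x > 0" by simp
  define e where "e = (\<lambda>v. d v / h v)"
  have e: "e v > 0" if "v \<in> V" for v using h d that by (simp add: e_def)
  obtain z where z: "(\<Sum>v\<in>V. d v * z v) = 0" "(\<Sum>v\<in>V. e v * (z v)\<^sup>2) = 1" "bil V M z z > 0"
    and max: "\<And>y. (\<Sum>v\<in>V. d v * y v) = 0 \<Longrightarrow> bil V M y y \<le> bil V M z z * (\<Sum>v\<in>V. e v * (y v)\<^sup>2)"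
    using rayleigh_maximizer[of V e d x M, OF fin _ x \<open>bil V M x x > 0\<close>] e by blast
  define \<mu> where "\<mu> = bil V M z z"
  define D where "D = (\<lambda>x y. \<Sum>v\<in>V. e v * x v * y v)"
  have D_sq: "(\<Sum>v\<in>V. e v * (y v)\<^sup>2) = D y y" for y by (simp add: D_def power2_eq_square mult.assoc)
  have Qh: "bil V M y h = (\<Sum>v\<in>V. d v * y v)" for y
    by (simp add: bil_eq d_def mult.commute)
  have Dh: "D y h = (\<Sum>v\<in>V. d v * y v)" for y
    unfolding D_def e_def using h by (intro sum.cong) (auto simp: less_imp_neq[THEN not_sym])
  \<comment> \<open>First variation of the Rayleigh quotient at \<open>z\<close>, along directions
    that stay in the hyperplane.\<close>
  have crit0: "bil V M z y = \<mu> * D z y" if "(\<Sum>v\<in>V. d v * y v) = 0" for y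
  proof -
    have "(2 * (bil V M z y - \<mu> * D z y)) * t + (bil V M y y - \<mu> * D y y) * t\<^sup>2 \<le> 0" for t
    proof -
      define u where "u = (\<lambda>v. z v + t * y v)"
      have "(\<Sum>v\<in>V. d v * u v) = (\<Sum>v\<in>V. d v * z v) + t * (\<Sum>v\<in>V. d v * y v)"
        by (simp add: u_def sum_distrib_left sum.distrib[symmetric] algebra_simps)
      then have "bil V M u u \<le> \<mu> * D u u" using max[of u] z that by (simp add: \<mu>_def D_sq)
      moreover have "bil V M u u = bil V M z z + 2 * t * bil V M z y + t\<^sup>2 * bil V M y y"
        unfolding u_def bil_add_left bil_add_right
        using bil_commute[of V M y z, OF sym] by (simp add: algebra_simps power2_eq_square)
      moreover have "D u u = D z z + 2 * t * D z y + t\<^sup>2 * D y y"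
        by (simp add: D_def u_def sum_distrib_left sum.distrib[symmetric] algebra_simps power2_eq_square)
      ultimately show ?thesis using z by (simp add: \<mu>_def D_sq algebra_simps)
    qed
    from linear_term_zero[OF this] show ?thesis by simp
  qed
  \<comment> \<open>The direction \<open>h\<close> can be added: \<open>bil V M z h\<close> and
    \<open>D z h\<close> both vanish, because \<open>z\<close> lies in the hyperplane.\<close>
  have crit: "bil V M z y = \<mu> * D z y" for y
  proof -
    have hh: "bil V M h h > 0 \<or> V = {}"
      unfolding Qh using h d fin by (auto intro!: sum_pos)
    show ?thesis
    proof (cases "V = {}")
      case False
      with hh have pos: "(\<Sum>v\<in>V. d v * h v) > 0" by (simp add: Qh)
      define s where "s = (\<Sum>v\<in>V. d v * y v) / (\<Sum>v\<in>V. d v * h v)"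
      define u where "u = (\<lambda>v. y v + (- s) * h v)"
      have "(\<Sum>v\<in>V. d v * u v) = (\<Sum>v\<in>V. d v * y v) - s * (\<Sum>v\<in>V. d v * h v)"
        by (simp add: u_def sum_distrib_left sum_subtractf[symmetric] algebra_simps)
      then have "(\<Sum>v\<in>V. d v * u v) = 0" using pos by (simp add: s_def)
      then have "bil V M z u = \<mu> * D z u" by (rule crit0)
      moreover have "bil V M z u = bil V M z y - s * bil V M z h"
        unfolding u_def bil_add_right by simp
      moreover have "D z u = D z y - s * D z h"
        by (simp add: D_def u_def sum_distrib_left sum_subtractf[symmetric] algebra_simps)
      ultimately show ?thesis using z by (simp add: Qh Dh)
    qed (simp add: bil_def D_def)
  qed
  have eig: "(\<Sum>w\<in>V. M v w * z w) = \<mu> * e v * z v" if v: "v \<in> V" for v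
  proof -
    have "bil V M z (\<lambda>w. if w = v then 1 else 0) = (\<Sum>w\<in>V. z w * M w v)"
      unfolding bil_eq using v fin by (simp add: if_distrib[of "\<lambda>x. _ * x"] cong: if_cong)
    also have "\<dots> = (\<Sum>w\<in>V. M v w * z w)"
      by (intro sum.cong refl) (simp add: sym[OF _ v] mult.commute)
    finally have "bil V M z (\<lambda>w. if w = v then 1 else 0) = (\<Sum>w\<in>V. M v w * z w)" .
    moreover have "D z (\<lambda>w. if w = v then 1 else 0) = e v * z v"
      unfolding D_def using v fin by (simp add: if_distrib[of "\<lambda>x. _ * x"] cong: if_cong)
    ultimately show ?thesis using crit[of "\<lambda>w. if w = v then 1 else 0"] by (simp add: mult.assoc)
  qed
  \<comment> \<open>On the normalized eigenvector the assumption \<open>bochner\<close> becomes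
    \<open>\<mu> \<le> \<mu>\<^sup>2\<close>, where \<open>\<mu>\<close> is positive.\<close>
  have "\<mu> \<le> (\<Sum>v\<in>V. h v * (\<mu> * e v * z v)\<^sup>2 / d v)"
    using bochner[of z] eig by (simp add: \<mu>_def)
  also have "\<dots> = (\<Sum>v\<in>V. \<mu>\<^sup>2 * (e v * (z v)\<^sup>2))"
  proof (intro sum.cong refl)
    fix v assume "v \<in> V"
    then have "h v > 0" "d v > 0" using h d by auto
    then show "h v * (\<mu> * e v * z v)\<^sup>2 / d v = \<mu>\<^sup>2 * (e v * (z v)\<^sup>2)"
      by (simp add: e_def power2_eq_square field_simps)
  qed
  also have "\<dots> = \<mu>\<^sup>2" using z by (simp add: sum_distrib_left[symmetric])
  finally have "\<mu> \<ge> 1" using z(3) by (simp add: \<mu>_def power2_eq_square)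
  have "V \<noteq> {}" using z(2) by auto
  define r where "r = (\<lambda>v. z v / h v)"
  have "Max (r ` V) \<in> r ` V" using fin \<open>V \<noteq> {}\<close> by (intro Max_in) auto
  then obtain v0 where m: "Max (r ` V) = r v0" "v0 \<in> V" by (rule imageE)
  have v0: "v0 \<in> V" "\<And>v. v \<in> V \<Longrightarrow> r v \<le> r v0"
    using m fin by (auto simp flip: m(1))
  have zr: "z v = h v * r v" if "v \<in> V" for v using h[OF that] by (simp add: r_def)
  have "r v0 > 0"
  proof (rule ccontr)
    assume "\<not> r v0 > 0"
    then have "r v \<le> 0" if "v \<in> V" for v using v0 that by force
    then have le: "d v * z v \<le> 0" if "v \<in> V" for v
      using that h d zr by (metis less_imp_le mult_nonneg_nonpos)
    have "(\<Sum>v\<in>V. - (d v * z v)) = 0" using z(1) by (simp add: sum_negf)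
    then have "\<forall>v\<in>V. - (d v * z v) = 0"
      using le by (subst (asm) sum_nonneg_eq_0_iff[OF fin]) auto
    then have "\<forall>v\<in>V. z v = 0" using d by force
    then show False using z(2) by simp
  qed
  \<comment> \<open>Where the ratio \<open>r\<close> to the vector \<open>h\<close> attains its
    maximum, row \<open>v\<close> of the eigenvalue equation has the value
    \<open>\<mu> * d v * r v0\<close>, at least \<open>d v * r v0\<close>. A neighbour with a
    smaller ratio would push the row strictly below that.\<close>
  have propagate: "r w = r v0" if v: "v \<in> V" "r v = r v0" and w: "w \<in> V" "M v w > 0" for v w
  proof (rule ccontr)
    assume "r w \<noteq> r v0"
    then have "r w < r v0" using v0 w by force
    have "(\<Sum>u\<in>V. M v u * z u) < (\<Sum>u\<in>V. M v u * (h u * r v0))"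
    proof (rule sum_strict_mono_ex1[OF fin])
      show "\<forall>u\<in>V. M v u * z u \<le> M v u * (h u * r v0)"
        using v0(2) nonneg[OF v(1)] h zr by (simp add: mult_left_mono)
      show "\<exists>u\<in>V. M v u * z u < M v u * (h u * r v0)"
        using w h zr \<open>r w < r v0\<close> by (intro bexI[of _ w]) auto
    qed
    also have "\<dots> = d v * r v0" by (simp add: d_def sum_distrib_right mult.assoc)
    finally have "\<mu> * (d v * r v0) < d v * r v0"
      using eig[OF v(1)] v zr[OF v(1)] h[OF v(1)] by (simp add: e_def)
    moreover have "d v * r v0 > 0" using d v \<open>r v0 > 0\<close> by simp
    ultimately show False using \<open>\<mu> \<ge> 1\<close> mult_right_mono[of 1 \<mu> "d v * r v0"] by simp
  qed
  \<comment> \<open>Two propagation steps reach every index, so \<open>z\<close> is a positive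
    multiple of \<open>h\<close>, contrary to its orthogonality to \<open>h\<close>.\<close>
  have "r v = r v0" if "v \<in> V" for v
    using irred[OF v0(1) that] propagate v0(1) that by metis
  then have "0 < (\<Sum>v\<in>V. d v * z v)"
    using fin \<open>V \<noteq> {}\<close> zr h d \<open>r v0 > 0\<close> by (intro sum_pos) auto
  then show False using z(1) by simp
qed

text \<open>Nonnegativity makes every row and column with \<open>d v = 0\<close> vanish. Such
  indices contribute 0 to all sums, in \<open>bochner\<close> too, and on the remaining ones
  \<open>d\<close> is strictly positive.\<close>

lemma local_global:
  fixes V :: "'v set" and M :: "'v \<Rightarrow> 'v \<Rightarrow> real" and h :: "'v \<Rightarrow> real"
  defines "d \<equiv> \<lambda>v. \<Sum>w\<in>V. M v w * h w"
  assumes fin: "finite V"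
    and sym: "\<And>v w. v \<in> V \<Longrightarrow> w \<in> V \<Longrightarrow> M v w = M w v"
    and nonneg: "\<And>v w. v \<in> V \<Longrightarrow> w \<in> V \<Longrightarrow> M v w \<ge> 0"
    and h: "\<And>v. v \<in> V \<Longrightarrow> h v > 0"
    and bochner: "\<And>x. bil V M x x \<le> (\<Sum>v\<in>V. h v * (\<Sum>w\<in>V. M v w * x w)\<^sup>2 / d v)"
    and irred: "\<And>v w. v \<in> V \<Longrightarrow> w \<in> V \<Longrightarrow> d v > 0 \<Longrightarrow> d w > 0 \<Longrightarrow>
      M v w > 0 \<or> (\<exists>u\<in>V. M v u > 0 \<and> M u w > 0)"
    and x: "(\<Sum>v\<in>V. d v * x v) = 0"
  shows "bil V M x x \<le> 0"
proof -
  define U where "U = {v \<in> V. d v > 0}"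
  have U: "U \<subseteq> V" "finite U" using fin by (auto simp: U_def)
  have M0: "M v w = 0" if "v \<in> V - U" "w \<in> V" for v w
  proof -
    have "(\<Sum>w\<in>V. M v w * h w) = 0"
    proof -
      have "d v \<ge> 0" unfolding d_def using that nonneg h
        by (intro sum_nonneg) (auto simp: less_imp_le)
      then show ?thesis using that by (auto simp: U_def d_def)
    qed
    then have "\<forall>w\<in>V. M v w * h w = 0"
      using that nonneg h by (subst (asm) sum_nonneg_eq_0_iff[OF fin]) (auto simp: less_imp_le)
    then show ?thesis using that h by force
  qed
  then have M0': "M w v = 0" if "v \<in> V - U" "w \<in> V" for v w
    using sym that by (metis DiffD1)
  have row: "(\<Sum>w\<in>V. M v w * y w) = (\<Sum>w\<in>U. M v w * y w)" if "v \<in> V" for v y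
    using U that M0' by (intro sum.mono_neutral_right[OF fin]) auto
  have QU: "bil V M y y = bil U M y y" for y
    unfolding bil_eq using U M0 row
    by (subst sum.mono_neutral_right[OF fin, of U]) (auto intro!: sum.cong)
  have dU: "d v = (\<Sum>w\<in>U. M v w * h w)" if "v \<in> V" for v unfolding d_def by (rule row[OF that])
  have "bil U M x x \<le> 0"
  proof (rule local_global_active[where h = h])
    show "finite U" by fact
    show "M v w = M w v" if "v \<in> U" "w \<in> U" for v w
      by (rule sym) (use that U in auto)
    show "M v w \<ge> 0" if "v \<in> U" "w \<in> U" for v w
      by (rule nonneg) (use that U in auto)
    show "h v > 0" if "v \<in> U" for v
      by (rule h) (use that U in auto)
    show "0 < (\<Sum>w\<in>U. M v w * h w)" if "v \<in> U" for v
      using that dU[of v] by (simp add: U_def)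
    show "bil U M y y \<le> (\<Sum>v\<in>U. h v * (\<Sum>w\<in>U. M v w * y w)\<^sup>2 / (\<Sum>w\<in>U. M v w * h w))" for y
    proof -
      have "(\<Sum>v\<in>V. h v * (\<Sum>w\<in>V. M v w * y w)\<^sup>2 / d v) = (\<Sum>v\<in>U. h v * (\<Sum>w\<in>V. M v w * y w)\<^sup>2 / d v)"
        using U M0 by (intro sum.mono_neutral_right[OF fin]) auto
      also have "\<dots> = (\<Sum>v\<in>U. h v * (\<Sum>w\<in>U. M v w * y w)\<^sup>2 / (\<Sum>w\<in>U. M v w * h w))"
        using U dU row by (intro sum.cong) auto
      finally show ?thesis using bochner[of y] QU by simp
    qed
    show "M v w > 0 \<or> (\<exists>u\<in>U. M v u > 0 \<and> M u w > 0)" if vw: "v \<in> U" "w \<in> U" for v w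
    proof -
      consider "M v w > 0" | u where "u \<in> V" "M v u > 0" "M u w > 0"
        using irred[of v w] vw unfolding U_def by blast
      then show ?thesis
      proof cases
        case 2
        \<comment> \<open>The intermediate index survives the restriction, since its row has a
          nonzero entry.\<close>
        then have "u \<in> U" using M0[of u w] vw U by (metis DiffI less_irrefl subsetD)
        then show ?thesis using 2 by blast
      qed simp
    qed
    have "(\<Sum>v\<in>V. d v * x v) = (\<Sum>v\<in>U. d v * x v)"
      using U M0 by (intro sum.mono_neutral_right[OF fin]) (auto simp: d_def)
    also have "\<dots> = (\<Sum>v\<in>U. (\<Sum>w\<in>U. M v w * h w) * x v)"
      using U dU by (intro sum.cong) auto
    finally show "(\<Sum>v\<in>U. (\<Sum>w\<in>U. M v w * h w) * x v) = 0" using x by simp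
  qed
  then show ?thesis by (simp add: QU)
qed

section \<open>Mixed sums of determinants\<close>

text \<open>The rows form a function rather than a matrix: a slot is then replaced by function
  update, and the argument is directly a point of a product measure.\<close>

definition rowdet :: "('n::finite \<Rightarrow> real^'n) \<Rightarrow> real" where
  "rowdet k = det (\<chi> i. k i)"

lemma linear_rowdet: "linear (\<lambda>x. rowdet (k(a := x)))"
proof
  show "rowdet (k(a := x + y)) = rowdet (k(a := x)) + rowdet (k(a := y))" for x y
    using det_row_add[of a "\<lambda>_. x" "\<lambda>_. y" k] by (simp add: rowdet_def fun_upd_def)
  show "rowdet (k(a := c *\<^sub>R x)) = c *\<^sub>R rowdet (k(a := x))" for c x
    using det_row_mul[of a c "\<lambda>_. x" k] unfolding scalar_mult_eq_scaleR by (simp add: rowdet_def fun_upd_def)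
qed

lemma rowdet_eq_rows:
  assumes "i \<noteq> j" "k i = k j"
  shows "rowdet k = 0"
  unfolding rowdet_def by (rule det_identical_rows[OF assms(1)]) (simp add: row_def assms(2) vec_eq_iff)

lemma rowdet_comp_permutes:
  assumes "p permutes UNIV"
  shows "rowdet (k \<circ> p) = of_int (sign p) * rowdet k"
  using det_permute_rows[OF assms, of "\<chi> i. k i"] by (simp add: rowdet_def)

lemma abs_rowdet_transpose: "\<bar>rowdet (k \<circ> Transposition.transpose a b)\<bar> = \<bar>rowdet k\<bar>"
  by (subst rowdet_comp_permutes) (auto simp: permutes_swap_id abs_mult sign_def)

text \<open>Cramer's rule: in every summand other than \<open>k a\<close> a row is repeated.\<close>

lemma rowdet_update_sum:
  "rowdet (k(a := \<Sum>i\<in>UNIV. \<gamma> i *\<^sub>R k i)) = \<gamma> a * rowdet k"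
proof -
  interpret L: linear "\<lambda>x. rowdet (k(a := x))" by (rule linear_rowdet)
  have "rowdet (k(a := \<Sum>i\<in>UNIV. \<gamma> i *\<^sub>R k i)) = (\<Sum>i\<in>UNIV. \<gamma> i * rowdet (k(a := k i)))"
    by (simp add: L.sum L.scale)
  also have "\<dots> = (\<Sum>i\<in>UNIV. if i = a then \<gamma> a * rowdet k else 0)"
    by (intro sum.cong refl) (auto intro: rowdet_eq_rows[of a])
  finally show ?thesis by simp
qed

lemma rowdet_expansion:
  fixes k :: "'n::finite \<Rightarrow> real^'n"
  assumes "rowdet k \<noteq> 0"
  obtains \<gamma> where "w = (\<Sum>i\<in>UNIV. \<gamma> i *\<^sub>R k i)"
proof -
  let ?A = "\<chi> i. k i"
  have "invertible (transpose ?A)" using assms by (simp add: rowdet_def invertible_det_nz)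
  then have "surj ((*v) (transpose ?A))" using matrix_right_invertible_surjective[of "transpose ?A"] by (auto simp: invertible_def)
  then obtain x where x: "w = transpose ?A *v x" by (meson surjD)
  have "w = (\<Sum>i\<in>UNIV. x $ i *\<^sub>R k i)"
    unfolding x matrix_mult_sum by (simp add: column_transpose row_def scalar_mult_eq_scaleR)
  then show thesis by (rule that)
qed

text \<open>The determinant is linear in row \<open>c\<close>. If it vanished at all of
  \<open>V\<close>, it would vanish on the span and so at the original row
  \<open>k c\<close>.\<close>

lemma rowdet_exchange:
  assumes "rowdet k \<noteq> 0" "span V = UNIV"
  obtains v where "v \<in> V" "rowdet (k(c := v)) \<noteq> 0"
proof -
  have "\<exists>v\<in>V. rowdet (k(c := v)) \<noteq> 0"
  proof (rule ccontr)
    assume "\<not> ?thesis"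
    then have "rowdet (k(c := k c)) = 0"
      using linear_eq_0_on_span[OF linear_rowdet[of k c], of V "k c"] assms(2) by auto
    then show False using assms(1) by simp
  qed
  then show thesis using that by blast
qed

text \<open>\<open>fact (CARD('n))\<close> times the mixed volume of the zonotopes with generators \<open>h i v *\<^sub>R v\<close>, \<open>v \<in> V\<close>.\<close>

definition mixed_sum :: "(real^'n) set \<Rightarrow> ('n::finite \<Rightarrow> real^'n \<Rightarrow> real) \<Rightarrow> real" where
  "mixed_sum V h = (\<Sum>k\<in>PiE UNIV (\<lambda>_. V). \<bar>rowdet k\<bar> * (\<Prod>i\<in>UNIV. h i (k i)))"

abbreviation pt :: "'a \<Rightarrow> 'a \<Rightarrow> real" where "pt v \<equiv> indicator {v}"

lemma finite_PiE_UNIV: "finite V \<Longrightarrow> finite (PiE (UNIV::'n::finite set) (\<lambda>_. V))"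
  by (intro finite_PiE) auto

lemma mixed_sum_nonneg:
  assumes "\<And>i v. v \<in> V \<Longrightarrow> h i v \<ge> 0"
  shows "mixed_sum V h \<ge> 0"
  unfolding mixed_sum_def using assms by (intro sum_nonneg mult_nonneg_nonneg prod_nonneg) auto

lemma mixed_sum_slot:
  fixes h :: "'n::finite \<Rightarrow> real^'n \<Rightarrow> real"
  assumes "finite V"
  shows "mixed_sum V (h(a := x)) = (\<Sum>v\<in>V. x v * mixed_sum V (h(a := pt v)))"
proof -
  define c where "c = (\<lambda>k. \<bar>rowdet k\<bar> * (\<Prod>i\<in>UNIV - {a}. h i (k i)))"
  have eq: "mixed_sum V (h(a := y)) = (\<Sum>k\<in>PiE UNIV (\<lambda>_. V). y (k a) * c k)" for y
    unfolding mixed_sum_def c_def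
    by (intro sum.cong refl, subst prod.remove[of UNIV a]) (auto intro!: prod.cong)
  have "(\<Sum>v\<in>V. x v * mixed_sum V (h(a := pt v))) = (\<Sum>k\<in>PiE UNIV (\<lambda>_. V). \<Sum>v\<in>V. x v * (pt v (k a) * c k))"
    unfolding eq sum_distrib_left by (rule sum.swap)
  also have "\<dots> = (\<Sum>k\<in>PiE UNIV (\<lambda>_. V). x (k a) * c k)"
  proof (intro sum.cong refl)
    fix k :: "'n \<Rightarrow> real^'n" assume "k \<in> PiE UNIV (\<lambda>_. V)"
    then have "k a \<in> V" by auto
    have "(\<Sum>v\<in>V. x v * (pt v (k a) * c k)) = (\<Sum>v\<in>V. if v = k a then x (k a) * c k else 0)"
      by (intro sum.cong refl) (auto simp: indicator_def)
    then show "(\<Sum>v\<in>V. x v * (pt v (k a) * c k)) = x (k a) * c k"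
      using assms \<open>k a \<in> V\<close> by simp
  qed
  finally show ?thesis by (simp add: eq)
qed

text \<open>An exchange of rows changes only the sign of the determinant. The symmetry holds for all
  slots alike, which lets the two special slots trade places with an averaged one.\<close>

lemma mixed_sum_transpose:
  fixes h :: "'n::finite \<Rightarrow> real^'n \<Rightarrow> real"
  shows "mixed_sum V (h \<circ> Transposition.transpose a b) = mixed_sum V h"
proof -
  let ?\<tau> = "Transposition.transpose a b"
  have p: "(\<Prod>i\<in>UNIV. (h \<circ> ?\<tau>) i (k i)) = (\<Prod>i\<in>UNIV. h i ((k \<circ> ?\<tau>) i))" for k
    by (rule prod.reindex_bij_witness[of _ ?\<tau> ?\<tau>]) auto
  show ?thesis
    unfolding mixed_sum_def
  proof (rule sum.reindex_bij_witness[of _ "\<lambda>k. k \<circ> ?\<tau>" "\<lambda>k. k \<circ> ?\<tau>"])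
    show "\<bar>rowdet (k \<circ> ?\<tau>)\<bar> * (\<Prod>i\<in>UNIV. h i ((k \<circ> ?\<tau>) i)) = \<bar>rowdet k\<bar> * (\<Prod>i\<in>UNIV. (h \<circ> ?\<tau>) i (k i))" for k
      by (simp only: p abs_rowdet_transpose)
  qed (auto simp: PiE_def fun_eq_iff)
qed

lemma mixed_sum_swap:
  assumes "a \<noteq> b"
  shows "mixed_sum V (h(a := x, b := y)) = mixed_sum V (h(a := y, b := x))"
proof -
  have eq: "h(a := x, b := y) = h(a := y, b := x) \<circ> Transposition.transpose a b"
    using assms by (auto simp: fun_eq_iff Transposition.transpose_def)
  show ?thesis by (subst eq) (rule mixed_sum_transpose)
qed

text \<open>Expanding two slots over point masses turns the mixed sum into a bilinear form, so that
  the results on matrices apply.\<close>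

lemma mixed_sum_bil:
  assumes "finite V" "a \<noteq> b"
  shows "mixed_sum V (h(a := x, b := y)) = bil V (\<lambda>v w. mixed_sum V (h(a := pt v, b := pt w))) x y"
proof -
  have twist: "h(a := p, b := q) = h(b := q, a := p)" for p q
    using assms(2) by (rule fun_upd_twist)
  have "mixed_sum V (h(a := x, b := y)) = (\<Sum>w\<in>V. y w * mixed_sum V (h(a := x, b := pt w)))"
    by (rule mixed_sum_slot[OF assms(1)])
  also have "\<dots> = (\<Sum>w\<in>V. y w * (\<Sum>v\<in>V. x v * mixed_sum V (h(a := pt v, b := pt w))))"
    unfolding twist by (simp only: mixed_sum_slot[OF assms(1), of "h(b := _)" a x])
  also have "\<dots> = (\<Sum>w\<in>V. \<Sum>v\<in>V. mixed_sum V (h(a := pt v, b := pt w)) * x v * y w)"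
    by (simp add: sum_distrib_left mult_ac)
  also have "\<dots> = bil V (\<lambda>v w. mixed_sum V (h(a := pt v, b := pt w))) x y"
    unfolding bil_def by (rule sum.swap)
  finally show ?thesis .
qed

lemma mixed_sum_points:
  fixes u :: "'n::finite \<Rightarrow> real^'n"
  assumes "finite V" "\<And>i. u i \<in> V"
  shows "mixed_sum V (\<lambda>i. pt (u i)) = \<bar>rowdet u\<bar>"
proof -
  have "(\<Prod>i\<in>UNIV. pt (u i) (k i)) = (if k = u then 1 else 0 :: real)" for k
    by (auto simp: fun_eq_iff indicator_def)
  then show ?thesis
    unfolding mixed_sum_def using assms finite_PiE_UNIV[of V, where 'n='n]
    by (simp add: if_distrib[of "\<lambda>x. _ * x"] PiE_def cong: if_cong)
qed

text \<open>All terms are nonnegative, so nothing cancels, and positivity means that the constant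
  rows can be completed to a basis. The completing rows on the right need not lie in
  \<open>V\<close>, which makes the criterion one of plain linear independence.\<close>

lemma mixed_sum_pos_iff:
  fixes h :: "'n::finite \<Rightarrow> real^'n \<Rightarrow> real"
  assumes V: "finite V" "span V = UNIV"
    and pos: "\<And>i v. i \<in> C \<Longrightarrow> v \<in> V \<Longrightarrow> h i v > 0"
    and pts: "\<And>i. i \<notin> C \<Longrightarrow> h i = pt (u i)" "\<And>i. i \<notin> C \<Longrightarrow> u i \<in> V"
  shows "mixed_sum V h > 0 \<longleftrightarrow> (\<exists>k. (\<forall>i. i \<notin> C \<longrightarrow> k i = u i) \<and> rowdet k \<noteq> 0)"
proof
  assume "mixed_sum V h > 0"
  then obtain k where k: "k \<in> PiE UNIV (\<lambda>_. V)" "\<bar>rowdet k\<bar> * (\<Prod>i\<in>UNIV. h i (k i)) \<noteq> 0"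
    unfolding mixed_sum_def by (metis (no_types, lifting) less_irrefl sum.neutral)
  then have "h i (k i) \<noteq> 0" for i by auto
  then have "k i = u i" if "i \<notin> C" for i
    using pts(1)[OF that] by (metis indicator_simps(2) singletonD)
  then show "\<exists>k. (\<forall>i. i \<notin> C \<longrightarrow> k i = u i) \<and> rowdet k \<noteq> 0" using k by auto
next
  assume "\<exists>k. (\<forall>i. i \<notin> C \<longrightarrow> k i = u i) \<and> rowdet k \<noteq> 0"
  then obtain k where k: "\<And>i. i \<notin> C \<Longrightarrow> k i = u i" "rowdet k \<noteq> 0" by blast
  \<comment> \<open>The completing rows are exchanged one at a time for elements of the spanning set
    \<open>V\<close>.\<close>
  have "\<exists>k'. (\<forall>i\<in>C'. k' i \<in> V) \<and> (\<forall>i. i \<notin> C' \<longrightarrow> k' i = k i) \<and> rowdet k' \<noteq> 0" if "finite C'" for C'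
    using that
  proof induction
    case empty
    then show ?case using k by auto
  next
    case (insert c C')
    then obtain k' where k': "\<forall>i\<in>C'. k' i \<in> V" "\<forall>i. i \<notin> C' \<longrightarrow> k' i = k i" "rowdet k' \<noteq> 0" by blast
    obtain v where "v \<in> V" "rowdet (k'(c := v)) \<noteq> 0" using rowdet_exchange[OF k'(3) V(2)] .
    moreover from this have "\<forall>i\<in>insert c C'. (k'(c := v)) i \<in> V" "\<forall>i. i \<notin> insert c C' \<longrightarrow> (k'(c := v)) i = k i"
      using k' by auto
    ultimately show ?case by blast
  qed
  from this[OF finite, of C] obtain k' where k': "\<forall>i\<in>C. k' i \<in> V" "\<forall>i. i \<notin> C \<longrightarrow> k' i = k i" "rowdet k' \<noteq> 0"
    by blast
  have in_V: "k' i \<in> V" for i using k' k pts by (cases "i \<in> C") auto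
  have "h i (k' i) > 0" for i
    using k' k pts pos in_V by (cases "i \<in> C") (auto simp: indicator_def)
  then have "0 < \<bar>rowdet k'\<bar> * (\<Prod>i\<in>UNIV. h i (k' i))"
    using k' by (intro mult_pos_pos prod_pos) auto
  also have "\<dots> \<le> mixed_sum V h"
    unfolding mixed_sum_def
  proof (rule member_le_sum)
    have "h i v \<ge> 0" if "v \<in> V" for i v
      using pos pts that by (cases "i \<in> C") (auto intro: less_imp_le)
    then show "0 \<le> \<bar>rowdet x\<bar> * (\<Prod>i\<in>UNIV. h i (x i))" if "x \<in> PiE UNIV (\<lambda>_. V) - {k'}" for x
      using that by (intro mult_nonneg_nonneg prod_nonneg) auto
  qed (use in_V V in \<open>auto intro!: finite_PiE\<close>)
  finally show "mixed_sum V h > 0" .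
qed

section \<open>Hyperbolicity of mixed sums\<close>

lemma bil_scale_kernel: "bil V (\<lambda>v w. c * M v w) x y = c * bil V M x y"
  by (simp add: bil_def sum_distrib_left algebra_simps)

text \<open>With all other rows fixed, the determinant is an alternating form in two vectors that
  depends only on their classes modulo the fixed rows. If it is not zero, these classes fill a
  plane, and the form is a multiple of the area form there.\<close>

lemma mixed_sum_hyperbolic_points:
  fixes u :: "'n::finite \<Rightarrow> real^'n"
  assumes V: "finite V" and ab: "a \<noteq> b"
    and h: "\<And>i. i \<noteq> a \<Longrightarrow> i \<noteq> b \<Longrightarrow> h i = pt (u i) \<and> u i \<in> V"
    and y: "\<And>v. v \<in> V \<Longrightarrow> y v \<ge> 0"
  shows "mixed_sum V (h(a := x, b := x)) * mixed_sum V (h(a := y, b := y)) \<le> (mixed_sum V (h(a := x, b := y)))\<^sup>2"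
proof -
  define M where "M = (\<lambda>v w. mixed_sum V (h(a := pt v, b := pt w)))"
  define \<omega> where "\<omega> = (\<lambda>v w. rowdet (u(a := v, b := w)))"
  have M: "M v w = \<bar>\<omega> v w\<bar>" if "v \<in> V" "w \<in> V" for v w
  proof -
    have "h(a := pt v, b := pt w) = (\<lambda>i. pt ((u(a := v, b := w)) i))"
      using h by (auto simp: fun_eq_iff)
    moreover have "(u(a := v, b := w)) i \<in> V" for i using h that by auto
    ultimately show ?thesis unfolding M_def \<omega>_def using mixed_sum_points[OF V, of "u(a := v, b := w)"] by simp
  qed
  have sym: "M v w = M w v" for v w unfolding M_def by (rule mixed_sum_swap[OF ab])
  have "bil V M x x * bil V M y y \<le> (bil V M x y)\<^sup>2"
  proof (cases "\<exists>v0\<in>V. \<exists>w0\<in>V. \<omega> v0 w0 \<noteq> 0")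
    case False
    then have "bil V M x y = 0" "bil V M x x = 0" for x y
      unfolding bil_def by (auto simp: M intro!: sum.neutral)
    then show ?thesis by simp
  next
    case True
    then obtain v0 w0 where nz: "\<omega> v0 w0 \<noteq> 0" by blast
    define k where "k = u(a := v0, b := w0)"
    have kdet: "rowdet k \<noteq> 0" using nz by (simp add: \<omega>_def k_def)
    have "\<forall>v. \<exists>\<gamma>. v = (\<Sum>i\<in>UNIV. \<gamma> i *\<^sub>R k i)"
      using rowdet_expansion[OF kdet] by metis
    then obtain \<gamma> where \<gamma>: "\<And>v. v = (\<Sum>i\<in>UNIV. \<gamma> v i *\<^sub>R k i)" by metis
    have skew: "\<omega> v w = - \<omega> w v" for v w
    proof -
      have "u(a := v, b := w) = u(a := w, b := v) \<circ> Transposition.transpose a b"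
        using ab by (auto simp: fun_eq_iff Transposition.transpose_def)
      then show ?thesis unfolding \<omega>_def
        using ab by (simp only: rowdet_comp_permutes permutes_swap_id UNIV_I) (simp add: sign_swap_id)
    qed
    have \<omega>v0: "\<omega> v0 w = \<gamma> w b * rowdet k" for w
    proof -
      have "u(a := v0, b := w) = k(b := w)" by (simp add: k_def)
      then show ?thesis unfolding \<omega>_def using rowdet_update_sum[of k b "\<gamma> w"] \<gamma>[of w] by simp
    qed
    have \<omega>w0: "\<omega> v w0 = \<gamma> v a * rowdet k" for v
    proof -
      have "u(a := v, b := w0) = k(a := v)" using ab by (simp add: k_def fun_upd_twist)
      then show ?thesis unfolding \<omega>_def using rowdet_update_sum[of k a "\<gamma> v"] \<gamma>[of v] by simp
    qed
    have \<omega>0: "\<omega> (k i) w = 0" if "i \<noteq> a" "i \<noteq> b" for i w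
      unfolding \<omega>_def using that ab by (intro rowdet_eq_rows[of i a]) (auto simp: k_def)
    have lin: "linear (\<lambda>v. \<omega> v w)" for w
    proof -
      have "(\<lambda>v. \<omega> v w) = (\<lambda>v. rowdet ((u(b := w))(a := v)))"
        unfolding \<omega>_def using ab by (simp add: fun_upd_twist)
      then show ?thesis using linear_rowdet by simp
    qed
    \<comment> \<open>The coordinates along \<open>k a\<close> and \<open>k b\<close> are those of
      the plane. All other basis vectors are rows already present and contribute 0.\<close>
    have \<omega>: "\<omega> v w = (\<gamma> v a * \<gamma> w b - \<gamma> v b * \<gamma> w a) * rowdet k" for v w
    proof -
      interpret L: linear "\<lambda>v. \<omega> v w" by (rule lin)
      have "\<omega> v w = (\<Sum>i\<in>UNIV. \<gamma> v i * \<omega> (k i) w)"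
        by (subst \<gamma>[of v]) (simp add: L.sum L.scale)
      also have "\<dots> = (\<Sum>i\<in>{a, b}. \<gamma> v i * \<omega> (k i) w)"
        using \<omega>0 by (intro sum.mono_neutral_right) auto
      also have "\<dots> = \<gamma> v a * \<omega> v0 w + \<gamma> v b * \<omega> w0 w"
        using ab by (simp add: k_def)
      finally show ?thesis using skew[of w0 w] by (simp add: \<omega>v0 \<omega>w0 algebra_simps)
    qed
    \<comment> \<open>The imaginary part of \<open>cnj z * w\<close> is the planar 2 by 2
      determinant, so complex numbers serve as coordinates of the plane.\<close>
    define z where "z = (\<lambda>v. Complex (\<gamma> v a) (\<gamma> v b))"
    have Mz: "M v w = \<bar>rowdet k\<bar> * \<bar>Im (cnj (z v) * z w)\<bar>" if "v \<in> V" "w \<in> V" for v w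
      using M[OF that] by (simp add: \<omega> z_def abs_mult mult.commute)
    show ?thesis
    proof (rule hyperbolic_from_hyperplane[where l = "\<lambda>v. cmod (z v)"])
      show "bil V M x x \<le> 0" if "(\<Sum>v\<in>V. cmod (z v) * x v) = 0" for x
      proof -
        have "bil V M x x = bil V (\<lambda>v w. \<bar>rowdet k\<bar> * \<bar>Im (cnj (z v) * z w)\<bar>) x x"
          unfolding bil_def by (intro sum.cong refl) (simp add: Mz)
        then show ?thesis
          using planar_hyperbolic[OF V that] by (simp add: bil_scale_kernel mult_nonneg_nonpos)
      qed
      show "0 \<le> bil V M y y" unfolding bil_def using y M by (intro sum_nonneg) auto
    qed (rule sym)
  qed
  then show ?thesis unfolding M_def by (simp only: mixed_sum_bil[OF V ab, symmetric])
qed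

text \<open>If \<open>v\<close> and \<open>w\<close> are not joined directly, then Cramer's rule shows that they agree, up to a nonzero
  factor, modulo the constant vectors \<open>u i\<close>, so that every neighbour \<open>t\<close> of \<open>v\<close> is one of \<open>w\<close>.\<close>

lemma mixed_sum_irreducible:
  fixes h :: "'n::finite \<Rightarrow> real^'n \<Rightarrow> real"
  assumes V: "finite V" "span V = UNIV" and ab: "a \<noteq> b" "a \<notin> C" "b \<notin> C"
    and pos: "\<And>i v. i \<in> C \<Longrightarrow> v \<in> V \<Longrightarrow> h i v > 0"
    and h: "\<And>i. i \<notin> C \<Longrightarrow> i \<noteq> a \<Longrightarrow> i \<noteq> b \<Longrightarrow> h i = pt (u i) \<and> u i \<in> V"
    and g: "\<And>v. v \<in> V \<Longrightarrow> g v > 0"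
    and vw: "v \<in> V" "w \<in> V" "mixed_sum V (h(a := pt v, b := g)) > 0" "mixed_sum V (h(a := pt w, b := g)) > 0"
  shows "mixed_sum V (h(a := pt v, b := pt w)) > 0 \<or>
    (\<exists>t\<in>V. mixed_sum V (h(a := pt v, b := pt t)) > 0 \<and> mixed_sum V (h(a := pt t, b := pt w)) > 0)"
proof -
  define D where "D = - insert a (insert b C)"
  have M_pos: "mixed_sum V (h(a := pt p, b := pt q)) > 0 \<longleftrightarrow>
      (\<exists>k. (\<forall>i\<in>D. k i = u i) \<and> k a = p \<and> k b = q \<and> rowdet k \<noteq> 0)" if "p \<in> V" "q \<in> V" for p q
  proof -
    have "mixed_sum V (h(a := pt p, b := pt q)) > 0 \<longleftrightarrow>
        (\<exists>k. (\<forall>i. i \<notin> C \<longrightarrow> k i = (u(a := p, b := q)) i) \<and> rowdet k \<noteq> 0)"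
      using pos h that ab by (intro mixed_sum_pos_iff[OF V]) auto
    also have "\<dots> \<longleftrightarrow> (\<exists>k. (\<forall>i\<in>D. k i = u i) \<and> k a = p \<and> k b = q \<and> rowdet k \<noteq> 0)"
      using ab by (intro ex_cong1) (auto simp: D_def)
    finally show ?thesis .
  qed
  have row: "\<exists>k. (\<forall>i\<in>D. k i = u i) \<and> k a = p \<and> rowdet k \<noteq> 0"
    if "p \<in> V" "mixed_sum V (h(a := pt p, b := g)) > 0" for p
  proof -
    have "mixed_sum V (h(a := pt p, b := g)) > 0 \<longleftrightarrow>
        (\<exists>k. (\<forall>i. i \<notin> insert b C \<longrightarrow> k i = (u(a := p)) i) \<and> rowdet k \<noteq> 0)"
      using pos h g that ab by (intro mixed_sum_pos_iff[OF V]) auto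
    then have "\<exists>k. (\<forall>i. i \<notin> insert b C \<longrightarrow> k i = (u(a := p)) i) \<and> rowdet k \<noteq> 0"
      using that(2) by (rule iffD1)
    then obtain k where "\<forall>i. i \<notin> insert b C \<longrightarrow> k i = (u(a := p)) i" "rowdet k \<noteq> 0"
      by (elim exE conjE)
    then show ?thesis using ab by (intro exI[of _ k]) (auto simp: D_def)
  qed
  obtain k0 where k0: "\<forall>i\<in>D. k0 i = u i" "k0 a = v" "rowdet k0 \<noteq> 0"
    using row[OF vw(1,3)] by (elim exE conjE)
  obtain k' where k': "\<forall>i\<in>D. k' i = u i" "k' a = w" "rowdet k' \<noteq> 0"
    using row[OF vw(2,4)] by (elim exE conjE)
  obtain t where t: "t \<in> V" "rowdet (k0(b := t)) \<noteq> 0" using rowdet_exchange[OF k0(3) V(2)] .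
  define k where "k = k0(b := t)"
  have k: "\<forall>i\<in>D. k i = u i" "k a = v" "k b = t" "rowdet k \<noteq> 0"
    using k0 t ab by (auto simp: k_def D_def)
  obtain \<gamma> where \<gamma>: "w = (\<Sum>i\<in>UNIV. \<gamma> i *\<^sub>R k i)" using rowdet_expansion[OF k(4)] .
  show ?thesis
  proof (cases "mixed_sum V (h(a := pt v, b := pt w)) > 0")
    case False
    \<comment> \<open>A nonzero coefficient at \<open>c\<close> would allow \<open>w\<close> to
      replace \<open>k c\<close> in the basis. With \<open>w\<close> moved to slot \<open>b\<close>
      and \<open>t\<close> to slot \<open>c\<close>, this basis would join \<open>v\<close> to
      \<open>w\<close> directly. For \<open>c = b\<close> the transposition is the identity.\<close>
    have zero: "\<gamma> c = 0" if c: "c \<in> insert b C" for c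
    proof -
      define \<tau> where "\<tau> = Transposition.transpose b c"
      define q where "q = k \<circ> \<tau>"
      have "w = (\<Sum>i\<in>UNIV. \<gamma> (\<tau> i) *\<^sub>R q i)"
        unfolding \<gamma> q_def by (rule sum.reindex_bij_witness[of _ \<tau> \<tau>]) (auto simp: \<tau>_def)
      then have "rowdet (q(b := w)) = \<gamma> (\<tau> b) * rowdet q"
        using rowdet_update_sum[of q b "\<lambda>i. \<gamma> (\<tau> i)"] by simp
      moreover have "\<tau> b = c" by (simp add: \<tau>_def)
      moreover have "rowdet q \<noteq> 0"
        using abs_rowdet_transpose[of k b c] k(4) by (auto simp: q_def \<tau>_def)
      moreover have "rowdet (q(b := w)) = 0"
      proof (rule ccontr)
        assume "rowdet (q(b := w)) \<noteq> 0"
        moreover have "\<forall>i\<in>D. (q(b := w)) i = u i" "(q(b := w)) a = v" "(q(b := w)) b = w"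
          using k c ab by (auto simp: q_def \<tau>_def D_def Transposition.transpose_def)
        ultimately show False using False M_pos[OF vw(1,2)] by blast
      qed
      ultimately show ?thesis by simp
    qed
    \<comment> \<open>Otherwise \<open>w\<close> would lie in the span of the constant rows, of
      which it is independent by the basis \<open>k'\<close>.\<close>
    have "\<gamma> a \<noteq> 0"
    proof
      assume "\<gamma> a = 0"
      interpret L: linear "\<lambda>x. rowdet (k'(a := x))" by (rule linear_rowdet)
      have "rowdet (k'(a := w)) = (\<Sum>i\<in>UNIV. \<gamma> i * rowdet (k'(a := k i)))"
        by (subst \<gamma>) (simp add: L.sum L.scale)
      also have "\<dots> = 0"
      proof (intro sum.neutral ballI)
        fix i
        show "\<gamma> i * rowdet (k'(a := k i)) = 0"
        proof (cases "i \<in> D")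
          case True
          then have "i \<noteq> a" "k i = k' i" using k k' by (auto simp: D_def)
          then have "rowdet (k'(a := k i)) = 0" by (intro rowdet_eq_rows[of i a]) auto
          then show ?thesis by simp
        next
          case False
          then show ?thesis using zero \<open>\<gamma> a = 0\<close> by (auto simp: D_def)
        qed
      qed
      also have "k'(a := w) = k'" using k' by auto
      finally show False using k' by simp
    qed
    \<comment> \<open>Hence \<open>w\<close> can replace \<open>v\<close> in the basis
      \<open>k\<close>, which keeps \<open>t\<close> in slot \<open>b\<close>.\<close>
    have "rowdet (k(a := w)) = \<gamma> a * rowdet k" using rowdet_update_sum[of k a \<gamma>] \<gamma> by simp
    then have "rowdet (k(a := w)) \<noteq> 0" using \<open>\<gamma> a \<noteq> 0\<close> k by simp
    moreover have "\<forall>i\<in>D. (k(a := w)) i = u i" "(k(a := w)) a = w" "(k(a := w)) b = t"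
      using k ab by (auto simp: D_def)
    ultimately have "mixed_sum V (h(a := pt w, b := pt t)) > 0"
      using M_pos[OF vw(2) t(1)] by blast
    then have "mixed_sum V (h(a := pt t, b := pt w)) > 0"
      by (subst mixed_sum_swap[OF ab(1)])
    moreover have "mixed_sum V (h(a := pt v, b := pt t)) > 0"
      using M_pos[OF vw(1) t(1)] k by blast
    ultimately show ?thesis using t by blast
  qed simp
qed

text \<open>\<open>C\<close> is the set of slots that are not point masses. Freezing one of them at
  each point of \<open>V\<close> gives the matrices \<open>N i\<close>, to which the induction
  hypothesis applies, and \<open>local_global\<close> with \<open>h = g\<close> reassembles
  them.\<close>

lemma mixed_sum_hyperbolic_pos:
  fixes h :: "'n::finite \<Rightarrow> real^'n \<Rightarrow> real"
  assumes V: "finite V" "span V = UNIV" and ab: "a \<noteq> b" and C: "a \<notin> C" "b \<notin> C"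
    and pos: "\<And>i v. i \<in> C \<Longrightarrow> v \<in> V \<Longrightarrow> h i v > 0"
    and h: "\<And>i. i \<notin> C \<Longrightarrow> i \<noteq> a \<Longrightarrow> i \<noteq> b \<Longrightarrow> h i = pt (u i) \<and> u i \<in> V"
    and y: "\<And>v. v \<in> V \<Longrightarrow> y v \<ge> 0"
  shows "mixed_sum V (h(a := x, b := x)) * mixed_sum V (h(a := y, b := y)) \<le> (mixed_sum V (h(a := x, b := y)))\<^sup>2"
  using finite[of C] C pos h y
\<comment> \<open>Freezing slot \<open>c\<close> changes \<open>h\<close> and \<open>u\<close>, and
  the hypothesis is then used for \<open>p\<close> against \<open>g\<close>, not for the given
  \<open>x\<close> and \<open>y\<close>.\<close>
proof (induction C arbitrary: h u x y)
  case empty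
  then show ?case by (intro mixed_sum_hyperbolic_points[OF V(1) ab]) auto
next
  case (insert c C)
  have c: "c \<noteq> a" "c \<noteq> b" using insert.prems by auto
  define g where "g = h c"
  define M where "M = (\<lambda>v w. mixed_sum V (h(a := pt v, b := pt w)))"
  define N where "N = (\<lambda>i v w. mixed_sum V ((h(c := pt i))(a := pt v, b := pt w)))"
  have bilM: "bil V M p q = mixed_sum V (h(a := p, b := q))" for p q
    unfolding M_def by (rule mixed_sum_bil[OF V(1) ab, symmetric])
  have bilN: "bil V (N i) p q = mixed_sum V ((h(c := pt i))(a := p, b := q))" for i p q
    unfolding N_def by (rule mixed_sum_bil[OF V(1) ab, symmetric])
  have g: "g v > 0" if "v \<in> V" for v unfolding g_def using insert.prems that by auto
  have g0: "g v \<ge> 0" if "v \<in> V" for v using g[OF that] by simp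
  have h_nonneg: "h i v \<ge> 0" if "i \<noteq> a" "i \<noteq> b" "v \<in> V" for i v
    using insert.prems(3)[of i v] insert.prems(4)[of i] that by (cases "i \<in> insert c C") (auto intro: less_imp_le)
  have M_nonneg: "M v w \<ge> 0" for v w
    unfolding M_def using h_nonneg by (intro mixed_sum_nonneg) auto
  have N_nonneg: "N i v w \<ge> 0" for i v w
    unfolding N_def using h_nonneg by (intro mixed_sum_nonneg) auto
  have sym: "M v w = M w v" for v w unfolding M_def by (rule mixed_sum_swap[OF ab])
  \<comment> \<open>The transposition of slots \<open>a\<close> and \<open>c\<close> moves the point
    mass at \<open>i\<close> into the averaged slot and the weight \<open>g\<close> into a special
    one.\<close>
  have row: "(\<Sum>w\<in>V. M i w * p w) = bil V (N i) p g" for i p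
  proof -
    have "(\<Sum>w\<in>V. M i w * p w) = mixed_sum V (h(a := pt i, b := p))"
      by (subst mixed_sum_slot[OF V(1)]) (simp add: M_def mult.commute)
    also have "\<dots> = mixed_sum V (h(a := pt i, b := p) \<circ> Transposition.transpose a c)"
      by (rule mixed_sum_transpose[symmetric])
    also have "h(a := pt i, b := p) \<circ> Transposition.transpose a c = (h(c := pt i))(a := g, b := p)"
      using ab c by (auto simp: fun_eq_iff g_def Transposition.transpose_def)
    also have "mixed_sum V ((h(c := pt i))(a := g, b := p)) = bil V (N i) p g"
      unfolding bilN by (rule mixed_sum_swap[OF ab])
    finally show ?thesis .
  qed
  have average: "bil V M p p = (\<Sum>i\<in>V. g i * bil V (N i) p p)" for p
  proof -
    have "bil V M p p = mixed_sum V ((h(a := p, b := p))(c := g))"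
      unfolding bilM using c by (intro arg_cong[of _ _ "mixed_sum V"]) (auto simp: g_def)
    also have "\<dots> = (\<Sum>i\<in>V. g i * mixed_sum V ((h(a := p, b := p))(c := pt i)))"
      by (rule mixed_sum_slot[OF V(1)])
    also have "(\<lambda>i. (h(a := p, b := p))(c := pt i)) = (\<lambda>i. (h(c := pt i))(a := p, b := p))"
      using c by (auto simp: fun_eq_iff)
    then have "(\<Sum>i\<in>V. g i * mixed_sum V ((h(a := p, b := p))(c := pt i))) = (\<Sum>i\<in>V. g i * bil V (N i) p p)"
      unfolding bilN by metis
    finally show ?thesis .
  qed
  have IH: "bil V (N i) p p * bil V (N i) g g \<le> (bil V (N i) p g)\<^sup>2" if "i \<in> V" for i p
    unfolding bilN
  proof (rule insert.IH[where u = "u(c := i)"])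
    show "a \<notin> C" "b \<notin> C" using insert.prems by auto
    show "0 < (h(c := pt i)) j v" if "j \<in> C" "v \<in> V" for j v
      using insert.prems(3)[of j v] insert.hyps that by auto
    show "(h(c := pt i)) j = pt ((u(c := i)) j) \<and> (u(c := i)) j \<in> V" if "j \<notin> C" "j \<noteq> a" "j \<noteq> b" for j
      using insert.prems(4)[of j] that \<open>i \<in> V\<close> by auto
    show "0 \<le> g v" if "v \<in> V" for v using g[OF that] by simp
  qed
  have bochner: "bil V M p p \<le> (\<Sum>i\<in>V. g i * (\<Sum>w\<in>V. M i w * p w)\<^sup>2 / (\<Sum>w\<in>V. M i w * g w))" for p
    unfolding average row
  proof (rule sum_mono)
    fix i assume i: "i \<in> V"
    have nn: "bil V (N i) g g \<ge> 0" unfolding bil_def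
      using g N_nonneg by (intro sum_nonneg) (auto simp: less_imp_le)
    show "g i * bil V (N i) p p \<le> g i * (bil V (N i) p g)\<^sup>2 / bil V (N i) g g"
    \<comment> \<open>In the degenerate case positivity of \<open>g\<close> forces
      \<open>N i\<close> to vanish on \<open>V\<close>, and both sides are 0 by the convention for
      division by 0.\<close>
    proof (cases "bil V (N i) g g = 0")
      case True
      have "N i v w = 0" if "v \<in> V" "w \<in> V" for v w
      proof -
        have "\<forall>v\<in>V. (\<Sum>w\<in>V. N i v w * g v * g w) = 0"
          using True unfolding bil_def
          by (subst (asm) sum_nonneg_eq_0_iff[OF V(1)]) (auto intro!: sum_nonneg mult_nonneg_nonneg g0 N_nonneg)
        then have "(\<Sum>w\<in>V. N i v w * g v * g w) = 0" using that by blast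
        then have "\<forall>w\<in>V. N i v w * g v * g w = 0"
          using that(1) by (subst (asm) sum_nonneg_eq_0_iff[OF V(1)]) (auto intro!: mult_nonneg_nonneg g0 N_nonneg)
        then have "N i v w * g v * g w = 0" using that by blast
        then show ?thesis using g[OF that(1)] g[OF that(2)] by simp
      qed
      then have "bil V (N i) p p = 0" by (simp add: bil_def)
      then show ?thesis using True by simp
    next
      case False
      then have "bil V (N i) g g > 0" using nn by simp
      then have "bil V (N i) p p \<le> (bil V (N i) p g)\<^sup>2 / bil V (N i) g g"
        using IH[OF i, of p] by (simp add: pos_le_divide_eq)
      then show ?thesis using g[OF i] by (simp add: mult_left_mono flip: times_divide_eq_right)
    qed
  qed
  have d: "(\<Sum>w\<in>V. M v w * g w) = mixed_sum V (h(a := pt v, b := g))" for v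
    by (subst mixed_sum_slot[OF V(1)]) (simp add: M_def mult.commute)
  have "bil V M x x * bil V M y y \<le> (bil V M x y)\<^sup>2"
  proof (rule hyperbolic_from_hyperplane[where l = "\<lambda>v. \<Sum>w\<in>V. M v w * g w"])
    show "bil V M p p \<le> 0" if "(\<Sum>v\<in>V. (\<Sum>w\<in>V. M v w * g w) * p v) = 0" for p
    proof (rule local_global[where h = g])
      show "M v w > 0 \<or> (\<exists>t\<in>V. M v t > 0 \<and> M t w > 0)"
        if "v \<in> V" "w \<in> V" "(\<Sum>w\<in>V. M v w * g w) > 0" "(\<Sum>u\<in>V. M w u * g u) > 0" for v w
        unfolding M_def using insert.prems g that unfolding d
        by (intro mixed_sum_irreducible[OF V ab, where C = "insert c C" and u = u and g = g]) auto
    qed (use V sym M_nonneg g bochner that in auto)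
    show "0 \<le> bil V M y y" unfolding bil_def
      using insert.prems(5) M_nonneg by (intro sum_nonneg mult_nonneg_nonneg) auto
  qed (rule sym)
  then show ?case by (simp only: bilM)
qed

section \<open>Random vectors\<close>

text \<open>Adding \<open>\<epsilon>\<close> to the weights makes them strictly positive; the
  special slots are overwritten and keep \<open>x\<close> and \<open>y\<close>. Both sides are
  polynomial in \<open>\<epsilon>\<close>, so the inequality survives the limit.\<close>

lemma mixed_sum_hyperbolic:
  fixes h :: "'n::finite \<Rightarrow> real^'n \<Rightarrow> real"
  assumes V: "finite V" "span V = UNIV" and ab: "a \<noteq> b"
    and h: "\<And>i v. v \<in> V \<Longrightarrow> h i v \<ge> 0"
    and y: "\<And>v. v \<in> V \<Longrightarrow> y v \<ge> 0"
  shows "mixed_sum V (h(a := x, b := x)) * mixed_sum V (h(a := y, b := y)) \<le> (mixed_sum V (h(a := x, b := y)))\<^sup>2"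
proof -
  define g where "g = (\<lambda>\<epsilon> i v. h i v + \<epsilon>)"
  have slot: "((\<lambda>\<epsilon>. ((g \<epsilon>)(a := p, b := q)) i v) \<longlongrightarrow> (h(a := p, b := q)) i v) (at_right 0)" for p q i v
    unfolding g_def by (auto intro!: tendsto_eq_intros)
  have lim: "((\<lambda>\<epsilon>. mixed_sum V ((g \<epsilon>)(a := p, b := q))) \<longlongrightarrow> mixed_sum V (h(a := p, b := q))) (at_right 0)" for p q
    unfolding mixed_sum_def by (intro tendsto_intros slot)
  have "eventually (\<lambda>\<epsilon>. mixed_sum V ((g \<epsilon>)(a := x, b := x)) * mixed_sum V ((g \<epsilon>)(a := y, b := y))
      \<le> (mixed_sum V ((g \<epsilon>)(a := x, b := y)))\<^sup>2) (at_right (0::real))"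
    unfolding eventually_at_right_field
  proof (intro exI[of _ 1] conjI allI impI)
    fix \<epsilon> :: real assume "\<epsilon> > 0"
    then show "mixed_sum V ((g \<epsilon>)(a := x, b := x)) * mixed_sum V ((g \<epsilon>)(a := y, b := y))
      \<le> (mixed_sum V ((g \<epsilon>)(a := x, b := y)))\<^sup>2"
      using h y by (intro mixed_sum_hyperbolic_pos[OF V ab, where C = "- {a, b}"]) (auto simp: g_def add_nonneg_pos)
  qed simp
  then show ?thesis
    by (intro tendsto_le[OF _ tendsto_power[OF lim] tendsto_mult[OF lim lim]]) auto
qed

section \<open>Expected determinants of independent rows\<close>

lemma rowdet_eq_sum:
  "rowdet k = (\<Sum>p | p permutes UNIV. of_int (sign p) * (\<Prod>i\<in>UNIV. k i $ p i))"
  by (simp add: rowdet_def det_def)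

text \<open>A crude form of Hadamard's inequality: the factorial counts the terms of the Leibniz
  formula. As a dominating function it is good enough.\<close>

lemma abs_rowdet_le:
  fixes k :: "'n::finite \<Rightarrow> real^'n"
  shows "\<bar>rowdet k\<bar> \<le> fact (CARD('n)) * (\<Prod>i\<in>UNIV. norm (k i))"
proof -
  have "\<bar>rowdet k\<bar> \<le> (\<Sum>p | p permutes (UNIV :: 'n set). \<bar>of_int (sign p) * (\<Prod>i\<in>UNIV. k i $ p i)\<bar>)"
    unfolding rowdet_eq_sum by (rule sum_abs)
  also have "\<dots> \<le> (\<Sum>p | p permutes (UNIV :: 'n set). \<Prod>i\<in>UNIV. norm (k i))"
  proof (rule sum_mono)
    fix p :: "'n \<Rightarrow> 'n"
    have "\<bar>of_int (sign p) * (\<Prod>i\<in>UNIV. k i $ p i)\<bar> = (\<Prod>i\<in>UNIV. \<bar>k i $ p i\<bar>)"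
      by (simp add: abs_mult abs_prod sign_def)
    also have "\<dots> \<le> (\<Prod>i\<in>UNIV. norm (k i))"
      by (intro prod_mono) (auto simp: component_le_norm_cart)
    finally show "\<bar>of_int (sign p) * (\<Prod>i\<in>UNIV. k i $ p i)\<bar> \<le> (\<Prod>i\<in>UNIV. norm (k i))" .
  qed
  also have "\<dots> = fact (CARD('n)) * (\<Prod>i\<in>UNIV. norm (k i))"
    by (simp add: card_permutations)
  finally show ?thesis .
qed

lemma borel_measurable_rowdet [measurable]:
  assumes "\<And>i. f i \<in> borel_measurable M"
  shows "(\<lambda>\<omega>. rowdet (\<lambda>i. f i \<omega>)) \<in> borel_measurable M"
proof -
  have "(\<lambda>\<omega>. f i \<omega> $ j) \<in> borel_measurable M" for i j
    using assms[of i] by (rule measurable_compose) simp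
  then show ?thesis unfolding rowdet_eq_sum by measurable
qed

definition mixed_integral :: "('n::finite \<Rightarrow> (real^'n) measure) \<Rightarrow> real" where
  "mixed_integral \<nu> = (\<integral>\<omega>. \<bar>rowdet \<omega>\<bar> \<partial>PiM UNIV \<nu>)"

text \<open>By independence a configuration \<open>k\<close> of values has the product of the single
  probabilities, and these are the weights of the mixed sum.\<close>

lemma integral_simple_rowdet:
  fixes \<nu> :: "'n::finite \<Rightarrow> (real^'n) measure"
  assumes \<nu>: "\<And>i. prob_space (\<nu> i)" "\<And>i. sets (\<nu> i) = sets borel"
    and s: "s \<in> borel_measurable borel" "finite V" "range s \<subseteq> V"
  shows "(\<integral>\<omega>. \<bar>rowdet (\<lambda>i. s (\<omega> i))\<bar> \<partial>PiM UNIV \<nu>) = mixed_sum V (\<lambda>i v. measure (\<nu> i) (s -` {v}))"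
proof -
  interpret product_prob_space \<nu> by (rule product_prob_spaceI) (rule \<nu>)
  let ?K = "PiE (UNIV :: 'n set) (\<lambda>_. V)"
  have finK: "finite ?K" using s by (intro finite_PiE_UNIV)
  have sets: "s -` {v} \<in> sets (\<nu> i)" for i v
    using measurable_sets[OF s(1), of "{v}"] \<nu> by simp
  have int1: "integrable (\<nu> i) (indicator (s -` {v}) :: _ \<Rightarrow> real)" for i v
  proof -
    interpret prob_space "\<nu> i" by (rule \<nu>)
    show ?thesis using sets by (intro integrable_real_indicator) (auto simp: emeasure_finite less_top[symmetric])
  qed
  have "\<bar>rowdet (\<lambda>i. s (\<omega> i))\<bar> = (\<Sum>k\<in>?K. \<bar>rowdet k\<bar> * (\<Prod>i\<in>UNIV. indicator (s -` {k i}) (\<omega> i)))" for \<omega>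
  proof -
    have "(\<Prod>i\<in>UNIV. indicator (s -` {k i}) (\<omega> i)) = (if k = (\<lambda>i. s (\<omega> i)) then 1 else 0 :: real)" for k
    proof (cases "k = (\<lambda>i. s (\<omega> i))")
      case False
      then obtain i where "k i \<noteq> s (\<omega> i)" by blast
      then show ?thesis using False by (subst prod_zero) (auto intro!: exI[of _ i])
    qed simp
    moreover have "(\<lambda>i. s (\<omega> i)) \<in> ?K" using s by auto
    ultimately show ?thesis using finK by (simp add: if_distrib[of "\<lambda>x. _ * x"] cong: if_cong)
  qed
  then have "(\<integral>\<omega>. \<bar>rowdet (\<lambda>i. s (\<omega> i))\<bar> \<partial>PiM UNIV \<nu>)
      = (\<integral>\<omega>. (\<Sum>k\<in>?K. \<bar>rowdet k\<bar> * (\<Prod>i\<in>UNIV. indicator (s -` {k i}) (\<omega> i))) \<partial>PiM UNIV \<nu>)"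
    by presburger
  also have "\<dots> = (\<Sum>k\<in>?K. \<bar>rowdet k\<bar> * (\<Prod>i\<in>UNIV. \<integral>v. indicator (s -` {k i}) v \<partial>\<nu> i))"
  proof (subst Bochner_Integration.integral_sum)
    show "integrable (PiM UNIV \<nu>) (\<lambda>\<omega>. \<bar>rowdet k\<bar> * (\<Prod>i\<in>UNIV. indicator (s -` {k i}) (\<omega> i)))" for k
      by (intro integrable_mult_right product_integrable_prod int1 finite)
    have "(\<integral>\<omega>. (\<Prod>i\<in>UNIV. indicator (s -` {k i}) (\<omega> i)) \<partial>PiM UNIV \<nu>)
        = (\<Prod>i\<in>UNIV. \<integral>v. indicator (s -` {k i}) v \<partial>\<nu> i :: real)" for k :: "'n \<Rightarrow> real^'n"
      by (rule product_integral_prod[OF finite int1])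
    then show "(\<Sum>k\<in>?K. \<integral>\<omega>. \<bar>rowdet k\<bar> * (\<Prod>i\<in>UNIV. indicator (s -` {k i}) (\<omega> i)) \<partial>PiM UNIV \<nu>)
        = (\<Sum>k\<in>?K. \<bar>rowdet k\<bar> * (\<Prod>i\<in>UNIV. \<integral>v. indicator (s -` {k i}) v \<partial>\<nu> i))"
      by (simp only: integral_mult_right_zero)
  qed
  also have "\<dots> = mixed_sum V (\<lambda>i v. measure (\<nu> i) (s -` {v}))"
    unfolding mixed_sum_def using \<nu>(2) by (intro sum.cong refl arg_cong2[of _ _ _ _ "(*)"] prod.cong) (simp add: sets_eq_imp_space_eq)
  finally show ?thesis .
qed

text \<open>A product of independent integrable norms is integrable. It dominates the determinant
  itself with \<open>d = 1\<close> and its approximations with \<open>d = 2\<close>.\<close>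

lemma integrable_rowdet_bound:
  fixes \<nu> :: "'n::finite \<Rightarrow> (real^'n) measure"
  assumes "\<And>i. prob_space (\<nu> i)" "\<And>i. integrable (\<nu> i) norm"
  shows "integrable (PiM UNIV \<nu>) (\<lambda>\<omega>. c * (\<Prod>i\<in>UNIV. d * norm (\<omega> i)))"
proof -
  interpret product_prob_space \<nu> by (rule product_prob_spaceI) (rule assms)
  show ?thesis
    by (intro integrable_mult_right product_integrable_prod assms finite)
qed

lemma measurable_component_UNIV:
  assumes "\<And>i. sets (\<nu> i) = sets borel"
  shows "(\<lambda>\<omega>. \<omega> i) \<in> borel_measurable (PiM UNIV \<nu>)"
  using measurable_component_singleton[of i UNIV \<nu>] measurable_cong_sets[OF refl assms] by blast

lemma integrable_rowdet:
  fixes \<nu> :: "'n::finite \<Rightarrow> (real^'n) measure"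
  assumes "\<And>i. prob_space (\<nu> i)" "\<And>i. sets (\<nu> i) = sets borel" "\<And>i. integrable (\<nu> i) norm"
  shows "integrable (PiM UNIV \<nu>) (\<lambda>\<omega>. \<bar>rowdet \<omega>\<bar>)"
proof (rule Bochner_Integration.integrable_bound)
  show "integrable (PiM UNIV \<nu>) (\<lambda>\<omega>. fact (CARD('n)) * (\<Prod>i\<in>UNIV. 1 * norm (\<omega> i)))"
    by (rule integrable_rowdet_bound) (rule assms)+
  show "(\<lambda>\<omega>. \<bar>rowdet \<omega>\<bar>) \<in> borel_measurable (PiM UNIV \<nu>)"
    using borel_measurable_rowdet[of "\<lambda>i \<omega>. \<omega> i"] measurable_component_UNIV[of \<nu>, OF assms(2)] by auto
  show "AE \<omega> in PiM UNIV \<nu>. norm \<bar>rowdet \<omega>\<bar> \<le> norm (fact (CARD('n)) * (\<Prod>i\<in>UNIV. 1 * norm (\<omega> i)))"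
    using abs_rowdet_le by (auto simp: prod_nonneg abs_mult)
qed

lemma mixed_integral_approx:
  fixes \<nu> :: "'n::finite \<Rightarrow> (real^'n) measure"
  assumes \<nu>: "\<And>i. prob_space (\<nu> i)" "\<And>i. sets (\<nu> i) = sets borel" "\<And>i. integrable (\<nu> i) norm"
    and s: "\<And>n. s n \<in> borel_measurable borel" "\<And>x. (\<lambda>n. s n x) \<longlonglongrightarrow> x" "\<And>n x. norm (s n x) \<le> 2 * norm x"
  shows "(\<lambda>n. \<integral>\<omega>. \<bar>rowdet (\<lambda>i. s n (\<omega> i))\<bar> \<partial>PiM UNIV \<nu>) \<longlonglongrightarrow> mixed_integral \<nu>"
  unfolding mixed_integral_def
proof (rule integral_dominated_convergence)
  note m = measurable_component_UNIV[of \<nu>, OF \<nu>(2)]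
  show "(\<lambda>\<omega>. \<bar>rowdet \<omega>\<bar>) \<in> borel_measurable (PiM UNIV \<nu>)"
    using borel_measurable_rowdet[of "\<lambda>i \<omega>. \<omega> i"] m by auto
  show "(\<lambda>\<omega>. \<bar>rowdet (\<lambda>i. s n (\<omega> i))\<bar>) \<in> borel_measurable (PiM UNIV \<nu>)" for n
    using borel_measurable_rowdet[of "\<lambda>i \<omega>. s n (\<omega> i)"] measurable_compose[OF m s(1)] by auto
  show "integrable (PiM UNIV \<nu>) (\<lambda>\<omega>. fact (CARD('n)) * (\<Prod>i\<in>UNIV. 2 * norm (\<omega> i)))"
    by (rule integrable_rowdet_bound) (rule \<nu>)+
  show "AE \<omega> in PiM UNIV \<nu>. (\<lambda>n. \<bar>rowdet (\<lambda>i. s n (\<omega> i))\<bar>) \<longlonglongrightarrow> \<bar>rowdet \<omega>\<bar>"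
    unfolding rowdet_eq_sum by (intro AE_I2 tendsto_intros s)
  show "AE \<omega> in PiM UNIV \<nu>. norm \<bar>rowdet (\<lambda>i. s n (\<omega> i))\<bar> \<le> fact (CARD('n)) * (\<Prod>i\<in>UNIV. 2 * norm (\<omega> i))" for n
  proof (intro AE_I2)
    fix \<omega> :: "'n \<Rightarrow> real^'n"
    have "\<bar>rowdet (\<lambda>i. s n (\<omega> i))\<bar> \<le> fact (CARD('n)) * (\<Prod>i\<in>UNIV. norm (s n (\<omega> i)))"
      by (rule abs_rowdet_le)
    also have "\<dots> \<le> fact (CARD('n)) * (\<Prod>i\<in>UNIV. 2 * norm (\<omega> i))"
      using s(3) by (intro mult_left_mono prod_mono) auto
    finally show "norm \<bar>rowdet (\<lambda>i. s n (\<omega> i))\<bar> \<le> fact (CARD('n)) * (\<Prod>i\<in>UNIV. 2 * norm (\<omega> i))" by simp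
  qed
qed

text \<open>The same simple function is applied to all covectors, so the three integrals become
  mixed sums over one finite set, and the inequality passes to the limit.\<close>

lemma mixed_integral_hyperbolic:
  fixes \<nu> :: "'n::finite \<Rightarrow> (real^'n) measure"
  assumes ab: "a \<noteq> b"
    and \<nu>: "\<And>i. prob_space (\<nu> i)" "\<And>i. sets (\<nu> i) = sets borel" "\<And>i. integrable (\<nu> i) norm"
    and \<alpha>: "prob_space \<alpha>" "sets \<alpha> = sets borel" "integrable \<alpha> norm"
    and \<beta>: "prob_space \<beta>" "sets \<beta> = sets borel" "integrable \<beta> norm"
  shows "mixed_integral (\<nu>(a := \<alpha>, b := \<alpha>)) * mixed_integral (\<nu>(a := \<beta>, b := \<beta>))
    \<le> (mixed_integral (\<nu>(a := \<alpha>, b := \<beta>)))\<^sup>2"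
proof -
  have "(\<lambda>x :: real^'n. x) \<in> borel_measurable borel" by simp
  from borel_measurable_implies_sequence_metric[OF this, of 0]
  obtain s :: "nat \<Rightarrow> real^'n \<Rightarrow> real^'n" where s: "\<And>n. simple_function borel (s n)" "\<And>x. (\<lambda>n. s n x) \<longlonglongrightarrow> x"
    "\<And>n x. norm (s n x) \<le> 2 * norm x"
    by auto
  have s_meas: "s n \<in> borel_measurable borel" for n using s(1) by (rule borel_measurable_simple_function)
  define I where "I = (\<lambda>n \<nu>'. \<integral>\<omega>. \<bar>rowdet (\<lambda>i. s n (\<omega> i))\<bar> \<partial>PiM UNIV \<nu>')"
  have lim: "(\<lambda>n. I n (\<nu>(a := p, b := q))) \<longlonglongrightarrow> mixed_integral (\<nu>(a := p, b := q))"
    if "p = \<alpha> \<or> p = \<beta>" "q = \<alpha> \<or> q = \<beta>" for p q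
    unfolding I_def using \<nu> \<alpha> \<beta> that by (intro mixed_integral_approx s_meas s) auto
  have "I n (\<nu>(a := \<alpha>, b := \<alpha>)) * I n (\<nu>(a := \<beta>, b := \<beta>)) \<le> (I n (\<nu>(a := \<alpha>, b := \<beta>)))\<^sup>2" for n
  proof -
    \<comment> \<open>\<open>Basis\<close> is adjoined to make \<open>V\<close> spanning. A basis
      vector that is not a value of \<open>s n\<close> gets weight 0, so the weights are only
      nonnegative.\<close>
    define V where "V = range (s n) \<union> Basis"
    have "finite (range (s n))" using simple_functionD(1)[OF s(1)] by simp
    then have V: "finite V" "span V = UNIV" "range (s n) \<subseteq> V"
      using span_mono[of Basis V] by (auto simp: V_def)
    define w where "w = (\<lambda>\<mu> v. measure \<mu> (s n -` {v}))"
    have I: "I n (\<nu>(a := p, b := q)) = mixed_sum V ((\<lambda>i. w (\<nu> i))(a := w p, b := w q))"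
      if "p = \<alpha> \<or> p = \<beta>" "q = \<alpha> \<or> q = \<beta>" for p q
    proof -
      have "I n (\<nu>(a := p, b := q)) = mixed_sum V (\<lambda>i. w ((\<nu>(a := p, b := q)) i))"
        unfolding I_def w_def using \<nu> \<alpha> \<beta> that by (intro integral_simple_rowdet s_meas V) auto
      also have "(\<lambda>i. w ((\<nu>(a := p, b := q)) i)) = (\<lambda>i. w (\<nu> i))(a := w p, b := w q)"
        by (auto simp: fun_eq_iff)
      finally show ?thesis .
    qed
    show ?thesis
      unfolding I[OF disjI1[OF refl] disjI1[OF refl]] I[OF disjI2[OF refl] disjI2[OF refl]] I[OF disjI1[OF refl] disjI2[OF refl]]
      by (rule mixed_sum_hyperbolic[OF V(1,2) ab]) (auto simp: w_def)
  qed
  then show ?thesis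
    using lim by (intro LIMSEQ_le[OF tendsto_mult[OF lim lim] tendsto_power[OF lim]]) auto
qed

section \<open>The space of \<open>C\<^sup>1\<close> maps\<close>

lemma topspace_C1_topology_subset: "topspace (C1_topology A) \<subseteq> C1_maps A"
  by (auto simp: C1_topology_def whitney_nbhd_def)

lemma space_C1_borel: "space (C1_borel A) = topspace (C1_topology A)"
  unfolding C1_borel_def by (rule space_measure_of) (auto dest: openin_subset)

lemma measurable_C1_borel:
  fixes F :: "('p::{t2_space,second_countable_topology} \<Rightarrow> real^'k::finite) \<Rightarrow> 'b::topological_space"
  assumes "continuous_map (C1_topology A) euclidean F"
  shows "F \<in> borel_measurable (C1_borel A)"
proof (rule borel_measurableI)
  fix S :: "'b set" assume "open S"
  then have "openin (C1_topology A) {f \<in> topspace (C1_topology A). F f \<in> S}"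
    using assms by (simp add: openin_continuous_map_preimage)
  then have "{f \<in> topspace (C1_topology A). F f \<in> S} \<in> sets (C1_borel A)"
    unfolding C1_borel_def by (subst sets_measure_of) (auto dest: openin_subset)
  moreover have "{f \<in> topspace (C1_topology A). F f \<in> S} = F -` S \<inter> space (C1_borel A)"
    by (auto simp: space_C1_borel)
  ultimately show "F -` S \<inter> space (C1_borel A) \<in> sets (C1_borel A)" by simp
qed

text \<open>Subbasic sets are centred at arbitrary maps, so those around \<open>f\<close> are open
  neighbourhoods of \<open>f\<close>. For functionals that see the 1-jet at \<open>p\<close> only,
  the compact set \<open>{p}\<close> suffices.\<close>

lemma continuous_map_C1I:
  fixes F :: "('p::{t2_space,second_countable_topology} \<Rightarrow> real^'k::finite) \<Rightarrow> 'b::metric_space"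
  assumes c: "c \<in> A" "p \<in> dom_ch c"
    and F: "\<And>f e. f \<in> C1_maps A \<Longrightarrow> e > 0 \<Longrightarrow> \<exists>d>0. \<forall>h\<in>whitney_nbhd A c {p} d f. dist (F h) (F f) < e"
  shows "continuous_map (C1_topology A) euclidean F"
  unfolding continuous_map_def
proof (intro conjI allI impI)
  fix U :: "'b set" assume "openin euclidean U"
  then have "open U" by simp
  let ?S = "{f \<in> topspace (C1_topology A). F f \<in> U}"
  show "openin (C1_topology A) ?S"
  proof (subst openin_subopen, intro ballI)
    fix f assume f: "f \<in> ?S"
    then have C1: "f \<in> C1_maps A" using topspace_C1_topology_subset by auto
    obtain e where e: "e > 0" "\<And>y. dist y (F f) < e \<Longrightarrow> y \<in> U"
      using \<open>open U\<close> f by (auto simp: open_dist)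
    obtain d where d: "d > 0" "\<forall>h\<in>whitney_nbhd A c {p} d f. dist (F h) (F f) < e"
      using F[OF C1 e(1)] by blast
    have "openin (C1_topology A) (whitney_nbhd A c {p} d f)"
      unfolding C1_topology_def using c d(1) C1 by (intro topology_generated_by_Basis CollectI exI[of _ c] exI[of _ "{p}"] exI[of _ d] exI[of _ f]) auto
    moreover from openin_subset[OF this] have "whitney_nbhd A c {p} d f \<subseteq> ?S"
      using d e by auto
    moreover have "f \<in> whitney_nbhd A c {p} d f"
      using C1 d(1) by (auto simp: whitney_nbhd_def onorm_zero)
    ultimately show "\<exists>T. openin (C1_topology A) T \<and> f \<in> T \<and> T \<subseteq> ?S" by blast
  qed
qed auto

lemma in_chart_apply:
  assumes "smooth_atlas A" "c \<in> A" "p \<in> dom_ch c"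
  shows "in_chart c f (map_ch c p) = f p"
  using assms by (auto simp: in_chart_def smooth_atlas_def homeomorphism_def)

lemma C1_maps_differentiable:
  assumes "f \<in> C1_maps A" "c \<in> A" "p \<in> dom_ch c"
  shows "in_chart c f differentiable at (map_ch c p)"
  using assms by (auto simp: C1_maps_def)

lemma continuous_map_eval:
  fixes A :: "('p::{t2_space,second_countable_topology}, 'm::finite) chart set"
  assumes A: "smooth_atlas A"
  shows "continuous_map (C1_topology A) euclidean (\<lambda>f. f p)"
proof -
  have "p \<in> (\<Union>c\<in>A. dom_ch c)" using A by (simp add: smooth_atlas_def)
  then obtain c where c: "c \<in> A" "p \<in> dom_ch c" by blast
  show ?thesis
  proof (rule continuous_map_C1I[OF c])
    fix f :: "'p \<Rightarrow> real^'a" and e :: real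
    assume "e > 0"
    then show "\<exists>d>0. \<forall>h\<in>whitney_nbhd A c {p} d f. dist (h p) (f p) < e"
      by (intro exI[of _ e]) (auto simp: whitney_nbhd_def in_chart_apply[OF A c] dist_norm norm_minus_commute)
  qed
qed

lemma continuous_map_diff_in:
  fixes A :: "('p::{t2_space,second_countable_topology}, 'm::finite) chart set"
  assumes c: "c \<in> A" "p \<in> dom_ch c"
  shows "continuous_map (C1_topology A) euclidean (\<lambda>f :: 'p \<Rightarrow> real^'k::finite. diff_in c f p $ i)"
proof (rule continuous_map_C1I[OF c])
  fix f :: "'p \<Rightarrow> real^'k" and e :: real
  assume f: "f \<in> C1_maps A" and "e > 0"
  \<comment> \<open>Each of the \<open>CARD('m)\<close> entries of the row is bounded by the
    operator norm, and the Euclidean norm of the row by their sum.\<close>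
  define d where "d = e / CARD('m)"
  have "d > 0" using \<open>e > 0\<close> by (simp add: d_def)
  moreover have "dist (diff_in c h p $ i) (diff_in c f p $ i) < e" if h: "h \<in> whitney_nbhd A c {p} d f" for h
  proof -
    define x where "x = map_ch c p"
    have hC: "h \<in> C1_maps A" using h by (simp add: whitney_nbhd_def)
    note df = C1_maps_differentiable[OF f c, folded x_def] and dh = C1_maps_differentiable[OF hC c, folded x_def]
    have "(\<lambda>v. frechet_derivative (in_chart c f) (at x) v - frechet_derivative (in_chart c h) (at x) v)
        = (*v) (diff_in c f p - diff_in c h p)"
    proof -
      have "jacobian (in_chart c g) (at x) *v v = frechet_derivative (in_chart c g) (at x) v"
        if "in_chart c g differentiable at x" for g :: "'p \<Rightarrow> real^'k" and v
        using that frechet_derivative_at[of "in_chart c g" _ x] by (simp add: jacobian_works)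
      then show ?thesis using df dh by (auto simp: diff_in_def x_def matrix_vector_mult_diff_rdistrib)
    qed
    then have "onorm ((*v) (diff_in c f p - diff_in c h p)) < d"
      using h by (simp add: whitney_nbhd_def x_def)
    then have lt: "\<bar>(diff_in c f p - diff_in c h p) $ i $ j\<bar> < d" for j
      using matrix_component_le_onorm[of "diff_in c f p - diff_in c h p" i j] by simp
    have "dist (diff_in c h p $ i) (diff_in c f p $ i) = norm ((diff_in c f p - diff_in c h p) $ i)"
      by (simp add: dist_norm norm_minus_commute)
    also have "\<dots> \<le> (\<Sum>j\<in>UNIV. \<bar>(diff_in c f p - diff_in c h p) $ i $ j\<bar>)" by (rule norm_le_l1_cart)
    also have "\<dots> < (\<Sum>j\<in>(UNIV :: 'm set). d)" using lt by (intro sum_strict_mono) auto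
    also have "\<dots> = e" by (simp add: d_def)
    finally show ?thesis .
  qed
  ultimately show "\<exists>d>0. \<forall>h\<in>whitney_nbhd A c {p} d f. dist (diff_in c h p $ i) (diff_in c f p $ i) < e" by blast
qed

lemma diff_in_concat_maps:
  fixes F :: "'k::finite \<Rightarrow> 'p::{t2_space,second_countable_topology} \<Rightarrow> real^1"
  assumes F: "\<And>i. F i \<in> C1_maps A" and c: "c \<in> A" "p \<in> dom_ch c"
  shows "diff_in c (concat_maps F) p $ i = diff_in c (F i) p $ 1"
proof -
  define x where "x = map_ch c p"
  define D where "D = (\<lambda>i. frechet_derivative (in_chart c (F i)) (at x))"
  have D: "(in_chart c (F i) has_derivative D i) (at x)" for i
    unfolding D_def x_def using C1_maps_differentiable[OF F c] frechet_derivative_works by blast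
  have "(in_chart c (concat_maps F) has_derivative (\<lambda>v. \<chi> i. D i v $ 1)) (at x)"
  proof (subst has_derivative_componentwise_within, intro ballI)
    fix b :: "real^'k" assume "b \<in> Basis"
    then obtain j where b: "b = axis j 1" by (auto simp: Basis_vec_def)
    have "((\<lambda>y. in_chart c (F j) y $ 1) has_derivative (\<lambda>v. D j v $ 1)) (at x)"
      using bounded_linear.has_derivative[OF bounded_linear_vec_nth D] .
    then show "((\<lambda>y. in_chart c (concat_maps F) y \<bullet> b) has_derivative (\<lambda>v. (\<chi> i. D i v $ 1) \<bullet> b)) (at x)"
      by (simp add: b inner_axis in_chart_def concat_maps_def)
  qed
  then have "frechet_derivative (in_chart c (concat_maps F)) (at x) = (\<lambda>v. \<chi> i. D i v $ 1)"
    using frechet_derivative_at by metis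
  then show ?thesis
    by (simp add: diff_in_def jacobian_def matrix_def vec_eq_iff D_def x_def)
qed

section \<open>Positive definite matrices and Gram determinants\<close>

lemma pos_def_det_pos:
  fixes G :: "real^'m^'m"
  assumes "\<And>v. v \<noteq> 0 \<Longrightarrow> v \<bullet> (G *v v) > 0"
  shows "det G > 0"
proof (rule ccontr)
  assume neg: "\<not> det G > 0"
  \<comment> \<open>the segment from \<open>G\<close> to the identity consists of invertible matrices\<close>
  define D where "D = (\<lambda>t. det (t *\<^sub>R G + (1 - t) *\<^sub>R mat 1))"
  have "continuous_on {0..1} D"
    unfolding D_def det_def by (intro continuous_intros)
  moreover have "D 0 = 1" "D 1 \<le> 0" using neg by (auto simp: D_def)
  ultimately obtain t where t: "t \<in> {0..1}" "D t = 0"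
    using IVT2'[of D 1 0 0] by auto
  then have "\<not> invertible (t *\<^sub>R G + (1 - t) *\<^sub>R mat 1)" by (simp add: D_def invertible_det_nz)
  then obtain v where v: "v \<noteq> 0" "(t *\<^sub>R G + (1 - t) *\<^sub>R mat 1) *v v = 0"
    using matrix_left_invertible_ker[of "t *\<^sub>R G + (1 - t) *\<^sub>R mat 1"] by (auto simp: invertible_left_inverse)
  have "0 = v \<bullet> ((t *\<^sub>R G + (1 - t) *\<^sub>R mat 1) *v v)" using v by simp
  also have "\<dots> = t * (v \<bullet> (G *v v)) + (1 - t) * (v \<bullet> v)"
    by (simp add: matrix_vector_mult_add_rdistrib scaleR_matrix_vector_assoc[symmetric] inner_add_right)
  also have "\<dots> > 0"
  proof (cases "t = 0")
    case False
    then have "t * (v \<bullet> (G *v v)) > 0" using assms[OF v(1)] t by simp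
    then show ?thesis using t by (simp add: add_pos_nonneg)
  qed (use v in simp)
  finally show False by simp
qed

text \<open>Substituting \<open>v = G *v w\<close> turns the form of the inverse at \<open>v\<close>
  into the form of \<open>G\<close> at \<open>w\<close>.\<close>

lemma pos_def_inverse:
  fixes G :: "real^'m^'m"
  assumes pd: "\<And>v. v \<noteq> 0 \<Longrightarrow> v \<bullet> (G *v v) > 0" and v: "v \<noteq> 0"
  shows "v \<bullet> (matrix_inv G *v v) > 0"
proof -
  have inv: "invertible G" using pos_def_det_pos[OF pd] by (simp add: invertible_det_nz)
  have G: "G *v (matrix_inv G *v v) = v"
    using someI_ex[OF inv[unfolded invertible_def]] by (simp add: matrix_vector_mul_assoc matrix_inv_def)
  define w where "w = matrix_inv G *v v"
  have "w \<noteq> 0" using G v by (auto simp: w_def)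
  have "v \<bullet> w = (G *v w) \<bullet> w" using G by (simp add: w_def)
  also have "\<dots> > 0" using pd[OF \<open>w \<noteq> 0\<close>] by (simp add: inner_commute)
  finally show ?thesis by (simp add: w_def)
qed

text \<open>The constant is the square root of the minimum on the unit sphere, and homogeneity gives
  the rest.\<close>

lemma quadratic_form_lower_bound:
  fixes H :: "real^'m^'m"
  assumes pd: "\<And>v. v \<noteq> 0 \<Longrightarrow> v \<bullet> (H *v v) > 0"
  obtains \<kappa> where "\<kappa> > 0" "\<And>v. \<kappa> * norm v \<le> sqrt (v \<bullet> (H *v v))"
proof -
  have "continuous_on (sphere 0 1) (\<lambda>v. v \<bullet> (H *v v))" by (intro continuous_intros)
  moreover have "axis undefined 1 \<in> sphere (0 :: real^'m) 1" by (simp add: norm_axis_1)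
  then have "sphere (0 :: real^'m) 1 \<noteq> {}" by blast
  ultimately obtain v0 where v0: "v0 \<in> sphere 0 1" "\<And>v. v \<in> sphere 0 1 \<Longrightarrow> v0 \<bullet> (H *v v0) \<le> v \<bullet> (H *v v)"
    using continuous_attains_inf[OF compact_sphere] by blast
  define \<kappa> where "\<kappa> = sqrt (v0 \<bullet> (H *v v0))"
  have "v0 \<noteq> 0" using v0(1) by auto
  show thesis
  proof
    show "\<kappa> > 0" using pd[OF \<open>v0 \<noteq> 0\<close>] by (simp add: \<kappa>_def)
    fix v :: "real^'m"
    show "\<kappa> * norm v \<le> sqrt (v \<bullet> (H *v v))"
    proof (cases "v = 0")
      case False
      have "v0 \<bullet> (H *v v0) \<le> (v /\<^sub>R norm v) \<bullet> (H *v (v /\<^sub>R norm v))"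
        using False by (intro v0) simp
      also have "\<dots> = (v \<bullet> (H *v v)) / (norm v)\<^sup>2"
        by (simp add: matrix_vector_mult_scaleR power2_eq_square divide_inverse)
      finally have "v0 \<bullet> (H *v v0) * (norm v)\<^sup>2 \<le> v \<bullet> (H *v v)"
        using False by (simp add: pos_le_divide_eq)
      then have "sqrt (v0 \<bullet> (H *v v0) * (norm v)\<^sup>2) \<le> sqrt (v \<bullet> (H *v v))" by simp
      then show ?thesis by (simp add: \<kappa>_def real_sqrt_mult)
    qed simp
  qed
qed

text \<open>The Gram matrix factors as \<open>D ** H ** transpose D\<close>, and in top degree
  \<open>D\<close> is square, so the determinant is multiplicative.\<close>

lemma gram_det:
  fixes a :: "'m::finite \<Rightarrow> real^'m" and H :: "real^'m^'m"
  shows "sqrt (det (\<chi> i j. a i \<bullet> (H *v a j))) = sqrt (det H) * \<bar>rowdet a\<bar>"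
proof -
  let ?D = "\<chi> i. a i"
  have "(\<chi> i j. a i \<bullet> (H *v a j)) = ?D ** H ** transpose ?D"
    by (simp add: vec_eq_iff matrix_matrix_mult_def matrix_vector_mult_def transpose_def inner_vec_def
        sum_distrib_left sum_distrib_right mult.assoc) (intro allI sum.swap)
  then have "det (\<chi> i j. a i \<bullet> (H *v a j)) = det H * (rowdet a)\<^sup>2"
    by (simp add: det_mul det_transpose rowdet_def power2_eq_square)
  then show ?thesis by (simp add: real_sqrt_mult)
qed

section \<open>Densities as mixed integrals\<close>

locale riemannian_point =
  fixes A :: "('p::{t2_space,second_countable_topology}, 'm::finite) chart set"
    and G :: "('p, 'm) chart \<Rightarrow> 'p \<Rightarrow> real^'m^'m"
    and p :: 'p
  assumes manifold: "riemannian_manifold A G"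
begin

definition chart :: "('p, 'm) chart" where "chart = chart_at A p"

definition H :: "real^'m^'m" where "H = matrix_inv (G chart p)"

definition conorm :: "real^'m \<Rightarrow> real" where "conorm a = sqrt (a \<bullet> (H *v a))"

definition covector :: "('p \<Rightarrow> real^1) \<Rightarrow> real^'m" where "covector f = diff_in chart f p $ 1"

lemma atlas: "smooth_atlas A"
  using manifold by (simp add: riemannian_manifold_def)

lemma chart: "chart \<in> A" "p \<in> dom_ch chart"
proof -
  have "p \<in> (\<Union>c\<in>A. dom_ch c)" using atlas by (simp add: smooth_atlas_def)
  then have "\<exists>c. c \<in> A \<and> p \<in> dom_ch c" by blast
  from someI_ex[OF this] show "chart \<in> A" "p \<in> dom_ch chart"
    by (simp_all add: chart_def chart_at_def)
qed

lemma metric_pos: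
  assumes "v \<noteq> 0"
  shows "0 < v \<bullet> (G chart p *v v)"
proof -
  have "riemannian_metric A G" using manifold by (simp add: riemannian_manifold_def)
  then have "\<forall>c\<in>A. \<forall>p\<in>dom_ch c. transpose (G c p) = G c p \<and> (\<forall>v. v \<noteq> 0 \<longrightarrow> 0 < v \<bullet> (G c p *v v))"
    unfolding riemannian_metric_def by (elim conjE)
  then show ?thesis using chart assms by blast
qed

lemma H_pos: "v \<noteq> 0 \<Longrightarrow> 0 < v \<bullet> (H *v v)"
  unfolding H_def by (rule pos_def_inverse) (rule metric_pos)

lemma det_H_nonneg: "0 \<le> det H"
  using pos_def_det_pos[OF H_pos] by simp

lemma conorm_nonneg [simp]: "0 \<le> conorm a"
  using H_pos[of a] by (cases "a = 0") (auto simp: conorm_def)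

lemma conorm_bound:
  obtains \<kappa> where "\<kappa> > 0" "\<And>a. \<kappa> * norm a \<le> conorm a"
  using quadratic_form_lower_bound[of H] H_pos unfolding conorm_def by blast

lemma continuous_conorm: "continuous_on S conorm"
  unfolding conorm_def by (intro continuous_intros)

lemma jac_real:
  fixes f :: "'p \<Rightarrow> real^1"
  shows "jac A G p f = conorm (covector f)"
  by (simp add: jac_def cometric_def conorm_def covector_def H_def chart_def det_1)

lemma jac_concat:
  fixes F :: "'m \<Rightarrow> 'p \<Rightarrow> real^1"
  assumes "\<And>i. F i \<in> C1_maps A"
  shows "jac A G p (concat_maps F :: 'p \<Rightarrow> real^'m) = sqrt (det H) * \<bar>rowdet (\<lambda>i. covector (F i))\<bar>"
  using gram_det[of "\<lambda>i. covector (F i)" H] diff_in_concat_maps[of F, OF assms chart]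
  by (simp add: jac_def cometric_def covector_def H_def chart_def)

lemma continuous_map_covector: "continuous_map (C1_topology A) euclidean covector"
  using continuous_map_diff_in[OF chart] unfolding covector_def .

lemma covector_measurable [measurable]: "covector \<in> borel_measurable (C1_borel A)"
  by (rule measurable_C1_borel[OF continuous_map_covector])

lemma conorm_measurable [measurable]: "conorm \<in> borel_measurable borel"
  by (rule borel_measurable_continuous_onI[OF continuous_conorm])

text \<open>The conditional law of the differential at \<open>p\<close> given the value 0, as a law
  of coordinate vectors in the chart that \<open>jac\<close> uses.\<close>

definition cov_law :: "('w, 'p, 1) random_field \<Rightarrow> (real^'m) measure" where
  "cov_law W = distr (rf_cond W p 0) borel covector"

context
  fixes P :: "'w measure" and W :: "('w, 'p, 1) random_field"
  assumes W: "z_KROK A G P W"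
begin

lemma rf_cond_prob: "prob_space (rf_cond W p x)"
  and rf_cond_sets: "sets (rf_cond W p x) = sets (C1_borel A)"
  using W by (auto simp: z_KROK_def regular_cond_prob_def)

lemma measurable_rf_cond: "f \<in> measurable (C1_borel A) N \<Longrightarrow> f \<in> measurable (rf_cond W p x) N"
  using measurable_cong_sets[OF rf_cond_sets refl] by blast

lemma space_rf_cond: "space (rf_cond W p x) \<subseteq> C1_maps A"
  using sets_eq_imp_space_eq[OF rf_cond_sets] topspace_C1_topology_subset by (simp add: space_C1_borel)

text \<open>In degree one the Jacobian is \<open>conorm\<close>, so its integral is the total mass
  of \<open>weighted_cond\<close>, which the z-KROK property makes finite.\<close>

lemma integrable_conorm: "integrable (rf_cond W p x) (\<lambda>f. conorm (covector f))"
proof (rule integrableI_nonneg)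
  show "(\<lambda>f. conorm (covector f)) \<in> borel_measurable (rf_cond W p x)"
    by (rule measurable_rf_cond) simp
  interpret finite_measure "weighted_cond A G (rf_cond W) p x" using W by (simp add: z_KROK_def)
  have "(\<integral>\<^sup>+f. ennreal (conorm (covector f)) \<partial>rf_cond W p x)
      = emeasure (weighted_cond A G (rf_cond W) p x) (space (rf_cond W p x))"
    unfolding weighted_cond_def jac_real
    by (subst emeasure_density) (auto intro!: measurable_rf_cond nn_integral_cong)
  then show "(\<integral>\<^sup>+f. ennreal (conorm (covector f)) \<partial>rf_cond W p x) < \<infinity>"
    by (simp add: less_top[symmetric])
qed simp

lemma cov_law_prob: "prob_space (cov_law W)"
  unfolding cov_law_def by (intro prob_space.prob_space_distr rf_cond_prob measurable_rf_cond) simp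

lemma cov_law_sets: "sets (cov_law W) = sets borel"
  by (simp add: cov_law_def)

lemma cov_law_integrable: "integrable (cov_law W) norm"
proof -
  obtain \<kappa> where \<kappa>: "\<kappa> > 0" "\<And>a. \<kappa> * norm a \<le> conorm a" using conorm_bound by blast
  have "integrable (rf_cond W p 0) (\<lambda>f. norm (covector f))"
  proof (rule Bochner_Integration.integrable_bound)
    show "integrable (rf_cond W p 0) (\<lambda>f. conorm (covector f) / \<kappa>)"
      using integrable_conorm by simp
    show "(\<lambda>f. norm (covector f)) \<in> borel_measurable (rf_cond W p 0)"
      by (rule measurable_rf_cond) simp
    show "AE f in rf_cond W p 0. norm (norm (covector f)) \<le> norm (conorm (covector f) / \<kappa>)"
      using \<kappa> by (auto simp: field_simps)
  qed
  then show ?thesis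
    unfolding cov_law_def by (subst integrable_distr_eq) (auto intro!: measurable_rf_cond)
qed

end

lemma inj_concat_maps: "inj (concat_maps :: ('k::finite \<Rightarrow> 'q \<Rightarrow> real^1) \<Rightarrow> 'q \<Rightarrow> real^'k)"
proof (rule injI)
  fix F F' :: "'k \<Rightarrow> 'q \<Rightarrow> real^1"
  assume eq: "(concat_maps F :: 'q \<Rightarrow> real^'k) = concat_maps F'"
  have "F i q $ 1 = F' i q $ 1" for i q
    using arg_cong[OF eq, of "\<lambda>g. g q $ i"] by (simp add: concat_maps_def)
  then show "F = F'" by (auto simp: fun_eq_iff vec_eq_iff forall_1)
qed

text \<open>The conditional law is a product carried along the injection \<open>concat_maps\<close>,
  under which the Jacobian pulls back to a determinant of covectors. Only the images of the factors
  under \<open>covector\<close> remain.\<close>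

lemma vol_density_inter_eq:
  fixes P :: "'w measure" and Ws :: "('w, 'p, 1) random_field list"
  assumes Ws: "\<And>i :: 'm. z_KROK A G P (nth_at Ws i)"
  shows "vol_density_inter A G Ws p
    = sqrt (det H) * mixed_integral (\<lambda>i :: 'm. cov_law (nth_at Ws i)) * (\<Prod>i\<in>(UNIV :: 'm set). rf_dens (nth_at Ws i) p 0)"
proof -
  define \<mu> where "\<mu> = (\<lambda>i :: 'm. rf_cond (nth_at Ws i) p 0)"
  let ?M = "PiM UNIV \<mu>"
  have vec0: "vec ((0 :: real^'m) $ i) = (0 :: real^1)" for i by (simp add: vec_eq_iff)
  have cov: "(\<lambda>\<omega>. covector (\<omega> i)) \<in> borel_measurable ?M" for i
    by (rule measurable_compose[OF measurable_component_singleton])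
       (use Ws in \<open>auto simp: \<mu>_def intro!: measurable_rf_cond\<close>)
  have jac: "jac A G p (concat_maps \<omega> :: 'p \<Rightarrow> real^'m) = sqrt (det H) * \<bar>rowdet (\<lambda>i. covector (\<omega> i))\<bar>"
    if "\<omega> \<in> space ?M" for \<omega>
  proof (rule jac_concat)
    fix i have "\<omega> i \<in> space (\<mu> i)" using that by (auto simp: space_PiM)
    then show "\<omega> i \<in> C1_maps A" using space_rf_cond[OF Ws[of i]] by (auto simp: \<mu>_def)
  qed
  have rd: "(\<lambda>\<omega>. \<bar>rowdet (\<lambda>i. covector (\<omega> i))\<bar>) \<in> borel_measurable ?M"
    using borel_measurable_rowdet[of "\<lambda>i \<omega>. covector (\<omega> i)", OF cov] by simp
  have meas: "(\<lambda>\<omega>. jac A G p (concat_maps \<omega> :: 'p \<Rightarrow> real^'m)) \<in> borel_measurable ?M"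
    using rd by (subst measurable_cong[OF jac]) auto
  have "(\<integral>f. jac A G p f \<partial>rf_cond (concat_fields Ws :: ('w, 'p, 'm) random_field) p 0)
      = (\<integral>f. jac A G p f \<partial>embed_measure ?M concat_maps)"
    by (simp add: concat_fields_def \<mu>_def vec0)
  also have "\<dots> = (\<integral>\<omega>. jac A G p (concat_maps \<omega> :: 'p \<Rightarrow> real^'m) \<partial>?M)"
    by (subst embed_measure_eq_distr[OF inj_concat_maps], subst integral_distr)
       (auto intro!: measurable_embed_measure1 measurable_embed_measure2 meas inj_concat_maps)
  also have "\<dots> = (\<integral>\<omega>. sqrt (det H) * \<bar>rowdet (\<lambda>i. covector (\<omega> i))\<bar> \<partial>?M)"
    by (rule Bochner_Integration.integral_cong[OF refl jac])
  also have "\<dots> = sqrt (det H) * (\<integral>\<omega>. \<bar>rowdet (\<lambda>i. covector (\<omega> i))\<bar> \<partial>?M)" by simp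
  also have "(\<integral>\<omega>. \<bar>rowdet (\<lambda>i. covector (\<omega> i))\<bar> \<partial>?M) = mixed_integral (\<lambda>i. cov_law (nth_at Ws i))"
  proof -
    let ?\<nu> = "\<lambda>i :: 'm. cov_law (nth_at Ws i)"
    have compose_eq: "compose (UNIV :: 'm set) covector = (\<lambda>\<omega> i. covector (\<omega> i))"
      by (simp add: fun_eq_iff compose_def)
    have m: "covector \<in> measurable (\<mu> i) (?\<nu> i)" for i
      using measurable_rf_cond[OF Ws covector_measurable] measurable_cong_sets[OF refl cov_law_sets[OF Ws]]
      unfolding \<mu>_def by blast
    \<comment> \<open>The product of the image measures is the image of the product.\<close>
    have "PiM UNIV (\<lambda>i. distr (\<mu> i) (?\<nu> i) covector) = distr ?M (PiM UNIV ?\<nu>) (compose UNIV covector)"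
      by (rule distr_PiM_finite_prob_space'[symmetric])
         (use Ws in \<open>auto simp: \<mu>_def intro!: rf_cond_prob cov_law_prob m[unfolded \<mu>_def]\<close>)
    also have "(\<lambda>i. distr (\<mu> i) (?\<nu> i) covector) = ?\<nu>"
      unfolding cov_law_def \<mu>_def by (intro ext distr_cong) auto
    finally have distr: "PiM UNIV ?\<nu> = distr ?M (PiM UNIV ?\<nu>) (compose UNIV covector)" .
    have "mixed_integral ?\<nu> = (\<integral>\<omega>. \<bar>rowdet (compose UNIV covector \<omega>)\<bar> \<partial>?M)"
      unfolding mixed_integral_def
    proof (subst distr, rule integral_distr)
      have "(\<lambda>\<omega>. covector (\<omega> i)) \<in> measurable ?M (?\<nu> i)" for i
        by (rule measurable_compose[OF measurable_component_singleton[of i UNIV \<mu>] m[of i]]) simp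
      then have "(\<lambda>\<omega> i. covector (\<omega> i)) \<in> measurable ?M (PiM UNIV ?\<nu>)"
        by (intro measurable_PiM_single') (auto simp: PiE_def cov_law_def)
      then show "compose UNIV covector \<in> measurable ?M (PiM UNIV ?\<nu>)"
        by (simp add: compose_eq)
      show "(\<lambda>\<omega>. \<bar>rowdet \<omega>\<bar>) \<in> borel_measurable (PiM UNIV ?\<nu>)"
        using borel_measurable_rowdet[of "\<lambda>i \<omega>. \<omega> i"] measurable_component_UNIV[of ?\<nu>, OF cov_law_sets[OF Ws]] by auto
    qed
    then show ?thesis by (simp add: compose_eq)
  qed
  finally show ?thesis
    by (simp add: vol_density_inter_def vol_density_def concat_fields_def vec0)
qed

end

section \<open>Fields with the same law\<close>

text \<open>A difference at \<open>z\<close> would persist on a neighbourhood, and a nonempty open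
  set is not null. Equality is asked on \<open>S\<close> only, as conditional laws are determined
  only where the density is positive.\<close>

lemma AE_lborel_eq_at_isCont:
  fixes u v :: "'a::euclidean_space \<Rightarrow> real"
  assumes "AE x in lborel. x \<in> S \<longrightarrow> u x = v x" "open S" "z \<in> S" "isCont u z" "isCont v z"
  shows "u z = v z"
proof (rule ccontr)
  assume "u z \<noteq> v z"
  have "isCont (\<lambda>x. u x - v x) z" using assms by simp
  then have "eventually (\<lambda>x. u x - v x \<noteq> 0) (at z)"
    using \<open>u z \<noteq> v z\<close> by (intro tendsto_imp_eventually_ne) (auto simp: isCont_def)
  then have "eventually (\<lambda>x. u x \<noteq> v x) (nhds z)"
    using \<open>u z \<noteq> v z\<close> by (simp add: eventually_nhds_conv_at)
  then obtain T where T: "open T" "z \<in> T" "\<forall>x\<in>T. u x \<noteq> v x" by (auto simp: eventually_nhds)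
  have "AE x in lborel. x \<notin> S \<inter> T" using assms(1) by eventually_elim (use T in auto)
  then have "S \<inter> T \<in> null_sets lborel"
    using assms(2) T(1) by (subst AE_iff_null_sets) auto
  then have "negligible (S \<inter> T)" by (simp add: negligible_iff_null_sets null_sets_completionI)
  then show False using open_not_negligible[of "S \<inter> T"] assms T by auto
qed

text \<open>The defining identity is the case of indicators. It says that mixing the kernel over
  \<open>V\<close> gives the law of the field restricted to values in \<open>V\<close> at
  \<open>p\<close>; as an equality of measures it extends to all nonnegative integrands.\<close>

lemma regular_cond_prob_nn_integral:
  fixes A :: "('p::{t2_space,second_countable_topology}, 'm::finite) chart set"
    and \<mu> :: "real^'k::finite \<Rightarrow> ('p \<Rightarrow> real^'k) measure"
  assumes A: "smooth_atlas A" and X: "X \<in> measurable P (C1_borel A)"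
    and rcp: "regular_cond_prob A P X p \<mu>"
    and \<Psi>: "\<Psi> \<in> borel_measurable (C1_borel A)" and V: "V \<in> sets borel"
  shows "(\<integral>\<^sup>+x. (\<integral>\<^sup>+f. \<Psi> f \<partial>\<mu> x) * indicator V x \<partial>distr P borel (\<lambda>\<omega>. X \<omega> p))
      = (\<integral>\<^sup>+f. \<Psi> f * indicator V (f p) \<partial>distr P (C1_borel A) X)"
proof -
  define \<eta> where "\<eta> = distr P borel (\<lambda>\<omega>. X \<omega> p)"
  define D where "D = density \<eta> (indicator V)"
  define Q where "Q = density (distr P (C1_borel A) X) (\<lambda>f. indicator V (f p))"
  have ev [measurable]: "(\<lambda>f. f p) \<in> borel_measurable (C1_borel A :: ('p \<Rightarrow> real^'k) measure)"
    by (rule measurable_C1_borel[OF continuous_map_eval[OF A]])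
  note X [measurable] V [measurable] \<Psi> [measurable]
  have Xp: "(\<lambda>\<omega>. X \<omega> p) \<in> borel_measurable P" by (rule measurable_compose[OF X ev])
  have \<mu>: "\<mu> \<in> measurable D (subprob_algebra (C1_borel A))"
  proof (rule measurable_subprob_algebra)
    show "subprob_space (\<mu> x)" "sets (\<mu> x) = sets (C1_borel A)" for x
      using rcp by (auto simp: regular_cond_prob_def intro: prob_space_imp_subprob_space)
    show "(\<lambda>x. emeasure (\<mu> x) B) \<in> borel_measurable D" if "B \<in> sets (C1_borel A)" for B
      using rcp that by (auto simp: regular_cond_prob_def D_def \<eta>_def)
  qed
  have meas_em: "(\<lambda>x. emeasure (\<mu> x) B) \<in> borel_measurable borel" if "B \<in> sets (C1_borel A)" for B
    using rcp that by (auto simp: regular_cond_prob_def)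
  have "bind D \<mu> = Q"
  proof (rule measure_eqI)
    have sets_bind: "sets (bind D \<mu>) = sets (C1_borel A)"
      using rcp by (intro sets_bind) (auto simp: regular_cond_prob_def D_def \<eta>_def)
    then show "sets (bind D \<mu>) = sets Q" by (simp add: Q_def)
    fix B assume "B \<in> sets (bind D \<mu>)"
    then have B: "B \<in> sets (C1_borel A)" by (simp add: sets_bind)
    note B [measurable]
    have "emeasure (bind D \<mu>) B = (\<integral>\<^sup>+x. emeasure (\<mu> x) B \<partial>D)"
      by (rule emeasure_bind[OF _ \<mu> B]) (simp add: D_def \<eta>_def)
    also have "\<dots> = (\<integral>\<^sup>+x\<in>V. emeasure (\<mu> x) B \<partial>\<eta>)"
      unfolding D_def using meas_em[OF B] by (subst nn_integral_density) (auto simp: \<eta>_def mult.commute)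
    also have "\<dots> = emeasure P {\<omega> \<in> space P. X \<omega> \<in> B \<and> X \<omega> p \<in> V}"
      using rcp B V by (simp add: regular_cond_prob_def \<eta>_def)
    also have "\<dots> = emeasure Q B"
    proof -
      have "emeasure Q B = (\<integral>\<^sup>+\<omega>. indicator V (X \<omega> p) * indicator B (X \<omega>) \<partial>P)"
        unfolding Q_def by (subst emeasure_density) (simp_all add: nn_integral_distr)
      also have "\<dots> = (\<integral>\<^sup>+\<omega>. indicator {\<omega> \<in> space P. X \<omega> \<in> B \<and> X \<omega> p \<in> V} \<omega> \<partial>P)"
        by (intro nn_integral_cong) (auto simp: indicator_def)
      also have "\<dots> = emeasure P {\<omega> \<in> space P. X \<omega> \<in> B \<and> X \<omega> p \<in> V}"
        using Xp by (intro nn_integral_indicator) measurable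
      finally show ?thesis by simp
    qed
    finally show "emeasure (bind D \<mu>) B = emeasure Q B" .
  qed
  then have eq: "(\<integral>\<^sup>+f. \<Psi> f \<partial>bind D \<mu>) = (\<integral>\<^sup>+f. \<Psi> f \<partial>Q)" by simp
  have inner: "(\<lambda>x. \<integral>\<^sup>+f. \<Psi> f \<partial>\<mu> x) \<in> borel_measurable \<eta>"
    using measurable_compose[OF \<mu> nn_integral_measurable_subprob_algebra[OF \<Psi>]] by (simp add: D_def)
  have "(\<integral>\<^sup>+f. \<Psi> f \<partial>bind D \<mu>) = (\<integral>\<^sup>+x. (\<integral>\<^sup>+f. \<Psi> f \<partial>\<mu> x) * indicator V x \<partial>\<eta>)"
    unfolding nn_integral_bind[OF \<Psi> \<mu>] unfolding D_def using inner
    by (subst nn_integral_density) (auto simp: \<eta>_def mult.commute)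
  moreover have "(\<integral>\<^sup>+f. \<Psi> f \<partial>Q) = (\<integral>\<^sup>+f. \<Psi> f * indicator V (f p) \<partial>distr P (C1_borel A) X)"
    unfolding Q_def by (subst nn_integral_density) (auto simp: mult.commute)
  ultimately show ?thesis using eq by (simp add: \<eta>_def)
qed

lemma regular_cond_prob_measurable:
  assumes rcp: "regular_cond_prob A P X p \<mu>" and \<Psi>: "\<Psi> \<in> borel_measurable (C1_borel A)"
  shows "(\<lambda>x. \<integral>\<^sup>+f. \<Psi> f \<partial>\<mu> x) \<in> borel_measurable borel"
proof (rule measurable_compose[OF _ nn_integral_measurable_subprob_algebra[OF \<Psi>]])
  show "\<mu> \<in> measurable borel (subprob_algebra (C1_borel A))"
  proof (rule measurable_subprob_algebra)
    show "subprob_space (\<mu> x)" "sets (\<mu> x) = sets (C1_borel A)" for x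
      using rcp by (auto simp: regular_cond_prob_def intro: prob_space_imp_subprob_space)
    show "(\<lambda>x. emeasure (\<mu> x) B) \<in> borel_measurable borel" if "B \<in> sets (C1_borel A)" for B
      using rcp that by (auto simp: regular_cond_prob_def)
  qed
qed

context riemannian_point
begin

context
  fixes P :: "'w measure" and X X' :: "('w, 'p, 1) random_field"
  assumes P: "prob_space P" and X: "z_KROK A G P X" and X': "z_KROK A G P X'"
    and law: "distr P (C1_borel A) (rf_map X') = distr P (C1_borel A) (rf_map X)"
begin

lemma z_KROK_map: "z_KROK A G P W \<Longrightarrow> rf_map (W :: ('w, 'p, 1) random_field) \<in> measurable P (C1_borel A)"
  by (simp add: z_KROK_def)

lemma value_law: "distr P borel (\<lambda>\<omega>. rf_map X' \<omega> p) = distr P borel (\<lambda>\<omega>. rf_map X \<omega> p)"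
proof -
  have ev: "(\<lambda>f. f p) \<in> borel_measurable (C1_borel A :: ('p \<Rightarrow> real^1) measure)"
    by (rule measurable_C1_borel[OF continuous_map_eval[OF atlas]])
  have "distr P borel (\<lambda>\<omega>. rf_map W \<omega> p) = distr (distr P (C1_borel A) (rf_map W)) borel (\<lambda>f. f p)"
    if "z_KROK A G P W" for W :: "('w, 'p, 1) random_field"
    by (subst distr_distr[OF ev z_KROK_map[OF that]]) (simp add: comp_def)
  then show ?thesis using X X' law by simp
qed

lemma z_KROK_distributed:
  "z_KROK A G P (W :: ('w, 'p, 1) random_field) \<Longrightarrow> distributed P lborel (\<lambda>\<omega>. rf_map W \<omega> p) (\<lambda>x. ennreal (rf_dens W p x))"
  by (simp add: z_KROK_def)

lemma z_KROK_isCont_dens: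
  assumes "z_KROK A G P (W :: ('w, 'p, 1) random_field)"
  shows "isCont (rf_dens W p) 0"
proof -
  have "isCont (\<lambda>(q, x). rf_dens W q x) (p, 0)" using assms by (simp add: z_KROK_def)
  then show ?thesis
    using isCont_o2[where f = "\<lambda>x. (p, x)" and a = 0 and g = "\<lambda>(q, x). rf_dens W q x"] by simp
qed

text \<open>Densities of the same law agree almost everywhere, and continuity at 0 fixes their value
  there.\<close>

lemma dens_eq: "rf_dens X' p 0 = rf_dens X p 0"
proof -
  have "distr P lborel Y = distr P borel Y" for Y :: "'w \<Rightarrow> real^1" by (rule distr_cong) auto
  then have "density lborel (\<lambda>x. ennreal (rf_dens X' p x)) = density lborel (\<lambda>x. ennreal (rf_dens X p x))"
    using z_KROK_distributed[OF X] z_KROK_distributed[OF X'] value_law by (simp add: distributed_def)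
  then have "AE x in lborel. ennreal (rf_dens X' p x) = ennreal (rf_dens X p x)"
    using z_KROK_distributed[OF X] z_KROK_distributed[OF X']
    by (subst (asm) sigma_finite_measure.density_unique_iff[OF sigma_finite_lborel]) (auto simp: distributed_def)
  then have "AE x in lborel. x \<in> UNIV \<longrightarrow> rf_dens X' p x = rf_dens X p x"
    by eventually_elim (use X X' in \<open>auto simp: z_KROK_def ennreal_inj\<close>)
  then show ?thesis
    using z_KROK_isCont_dens X X' by (intro AE_lborel_eq_at_isCont[where S = UNIV]) auto
qed

lemma weighted_cond_integral:
  assumes W: "z_KROK A G P (W :: ('w, 'p, 1) random_field)" and \<Phi>: "\<Phi> \<in> borel_measurable (C1_borel A)"
  shows "(\<integral>f. \<Phi> f \<partial>weighted_cond A G (rf_cond W) p x) = (\<integral>f. conorm (covector f) * \<Phi> f \<partial>rf_cond W p x)"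
  unfolding weighted_cond_def jac_real
  using measurable_rf_cond[OF W \<Phi>] measurable_rf_cond[OF W, of "\<lambda>f. conorm (covector f)" borel]
  by (subst integral_density) auto

text \<open>Equal laws determine the conditional integrals only for almost every value
  \<open>x\<close>. Where the density is positive this is almost everywhere in the Lebesgue sense,
  and continuity at 0 then selects the value at \<open>x = 0\<close>.\<close>

lemma weighted_cond_eq:
  fixes \<Phi> :: "('p \<Rightarrow> real^1) \<Rightarrow> real"
  assumes \<Phi>: "continuous_map (C1_topology A) euclideanreal \<Phi>" "bounded (range \<Phi>)" "\<And>f. 0 \<le> \<Phi> f"
    and dens: "rf_dens X p 0 \<noteq> 0"
  shows "(\<integral>f. \<Phi> f \<partial>weighted_cond A G (rf_cond X') p 0) = (\<integral>f. \<Phi> f \<partial>weighted_cond A G (rf_cond X) p 0)"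
proof -
  have \<Phi>m [measurable]: "\<Phi> \<in> borel_measurable (C1_borel A)" by (rule measurable_C1_borel[OF \<Phi>(1)])
  define \<Psi> where "\<Psi> = (\<lambda>f. ennreal (conorm (covector f) * \<Phi> f))"
  have \<Psi>: "\<Psi> \<in> borel_measurable (C1_borel A)" unfolding \<Psi>_def by measurable
  define u where "u = (\<lambda>(W :: ('w, 'p, 1) random_field) x. \<integral>f. \<Phi> f \<partial>weighted_cond A G (rf_cond W) p x)"
  define U where "U = (\<lambda>(W :: ('w, 'p, 1) random_field) x. \<integral>\<^sup>+f. \<Psi> f \<partial>rf_cond W p x)"
  have u: "u W x = enn2real (U W x)" if "z_KROK A G P W" for W :: "('w, 'p, 1) random_field" and x
    unfolding u_def U_def \<Psi>_def weighted_cond_integral[OF that \<Phi>m]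
    using \<Phi>(3) that by (intro integral_eq_nn_integral AE_I2 mult_nonneg_nonneg conorm_nonneg measurable_rf_cond) auto
  have cont: "isCont (u W) 0" if "z_KROK A G P W" for W :: "('w, 'p, 1) random_field"
  proof -
    have "bounded (\<Phi> ` topspace (C1_topology A))" using \<Phi>(2) by (rule bounded_subset) auto
    then have "isCont (\<lambda>(q, x). \<integral>f. \<Phi> f \<partial>weighted_cond A G (rf_cond W) q x) (p, 0)"
      using that \<Phi>(1) by (auto simp: z_KROK_def)
    then show ?thesis unfolding u_def
      using isCont_o2[where f = "\<lambda>x. (p, x)" and a = 0 and g = "\<lambda>(q, x). \<integral>f. \<Phi> f \<partial>weighted_cond A G (rf_cond W) q x"] by simp
  qed
  define \<eta> where "\<eta> = distr P borel (\<lambda>\<omega>. rf_map X \<omega> p)"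
  have rcp: "regular_cond_prob A P (rf_map W) p (rf_cond W p)" if "z_KROK A G P W" for W :: "('w, 'p, 1) random_field"
    using that by (simp add: z_KROK_def)
  have Um: "U W \<in> borel_measurable \<eta>" if "z_KROK A G P W" for W :: "('w, 'p, 1) random_field"
    unfolding U_def \<eta>_def using regular_cond_prob_measurable[OF rcp[OF that] \<Psi>] by simp
  have ker: "(\<integral>\<^sup>+x. U X' x * indicator V x \<partial>\<eta>) = (\<integral>\<^sup>+x. U X x * indicator V x \<partial>\<eta>)" if "V \<in> sets borel" for V
    using regular_cond_prob_nn_integral[OF atlas z_KROK_map[OF X] rcp[OF X] \<Psi> that]
      regular_cond_prob_nn_integral[OF atlas z_KROK_map[OF X'] rcp[OF X'] \<Psi> that]
    by (simp add: U_def \<eta>_def value_law law)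
  \<comment> \<open>\<open>U X'\<close> and \<open>U X\<close> have the same integral over every
    Borel set of values, so they agree almost everywhere for the law of the value.\<close>
  have "density \<eta> (U X') = density \<eta> (U X)"
  proof (rule measure_eqI)
    fix V assume "V \<in> sets (density \<eta> (U X'))"
    then have V: "V \<in> sets borel" by (simp add: \<eta>_def)
    then show "emeasure (density \<eta> (U X')) V = emeasure (density \<eta> (U X)) V"
      using Um[OF X] Um[OF X'] ker by (simp add: emeasure_density \<eta>_def)
  qed simp
  moreover have "sigma_finite_measure \<eta>"
  proof -
    have "prob_space \<eta>" unfolding \<eta>_def
      using z_KROK_distributed[OF X] by (intro prob_space.prob_space_distr[OF P]) (auto simp: distributed_def)
    then show ?thesis by (simp add: prob_space_imp_sigma_finite)
  qed
  ultimately have ae_law: "AE x in \<eta>. U X' x = U X x"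
    using Um[OF X] Um[OF X'] sigma_finite_measure.density_unique_iff by blast
  have law_dens: "\<eta> = density lborel (\<lambda>x. ennreal (rf_dens X p x))"
  proof -
    have "distr P borel (\<lambda>\<omega>. rf_map X \<omega> p) = distr P lborel (\<lambda>\<omega>. rf_map X \<omega> p)" by (rule distr_cong) auto
    then show ?thesis using z_KROK_distributed[OF X] by (simp add: distributed_def \<eta>_def)
  qed
  have ae: "AE x in lborel. 0 < rf_dens X p x \<longrightarrow> U X' x = U X x"
    using ae_law z_KROK_distributed[OF X] unfolding law_dens
    by (subst (asm) AE_density) (auto simp: distributed_def)
  have "rf_dens X p 0 > 0" using dens X by (simp add: z_KROK_def less_le)
  then have "eventually (\<lambda>x. rf_dens X p x > 0) (at 0)"
    using z_KROK_isCont_dens[OF X] by (intro order_tendstoD) (auto simp: isCont_def)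
  then have "eventually (\<lambda>x. rf_dens X p x > 0) (nhds 0)"
    using \<open>rf_dens X p 0 > 0\<close> by (simp add: eventually_nhds_conv_at)
  then obtain S where S: "open S" "0 \<in> S" "\<forall>x\<in>S. rf_dens X p x > 0" by (auto simp: eventually_nhds)
  have "AE x in lborel. x \<in> S \<longrightarrow> u X' x = u X x"
    using ae by eventually_elim (use S u[OF X] u[OF X'] in auto)
  then have "u X' 0 = u X 0"
    by (rule AE_lborel_eq_at_isCont) (use S cont X X' in auto)
  then show ?thesis by (simp add: u_def)
qed

text \<open>Only integrals of bounded continuous functions against the weighted laws are known to
  agree. A function of linear growth is \<open>conorm\<close> times a bounded one, and the factor
  \<open>conorm\<close> is the weight.\<close>

lemma cov_law_integral_eq:
  fixes \<psi> :: "real^'m \<Rightarrow> real"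
  assumes \<psi>: "continuous_on UNIV \<psi>" "\<And>a. 0 \<le> \<psi> a" "\<And>a. \<psi> a \<le> K * norm a"
    and dens: "rf_dens X p 0 \<noteq> 0"
  shows "(\<integral>a. \<psi> a \<partial>cov_law X') = (\<integral>a. \<psi> a \<partial>cov_law X)"
proof -
  obtain \<kappa> where \<kappa>: "\<kappa> > 0" "\<And>a. \<kappa> * norm a \<le> conorm a" using conorm_bound by blast
  have K: "\<psi> a \<le> (\<bar>K\<bar> / \<kappa>) * conorm a" for a
  proof -
    have "\<psi> a \<le> \<bar>K\<bar> * norm a" using \<psi>(3)[of a] mult_right_mono[OF abs_ge_self[of K], of "norm a"] by simp
    also have "\<dots> = (\<bar>K\<bar> / \<kappa>) * (\<kappa> * norm a)" using \<kappa>(1) by simp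
    also have "\<dots> \<le> (\<bar>K\<bar> / \<kappa>) * conorm a" using \<kappa> by (intro mult_left_mono) auto
    finally show ?thesis .
  qed
  \<comment> \<open>\<open>\<psi> / conorm\<close> need not be continuous where the covector vanishes, so the denominator is cut off\<close>
  define \<phi> where "\<phi> = (\<lambda>n a. \<psi> a / max (conorm a) (1 / real (Suc n)))"
  have max_pos: "max (conorm a) (1 / real (Suc n)) > 0" for a n by (simp add: less_max_iff_disj)
  have \<phi>_nonneg: "0 \<le> \<phi> n a" for n a unfolding \<phi>_def using \<psi>(2) max_pos by (simp add: less_imp_le)
  have \<phi>_bound: "\<phi> n a \<le> \<bar>K\<bar> / \<kappa>" for n a
  proof -
    have "\<psi> a \<le> (\<bar>K\<bar> / \<kappa>) * max (conorm a) (1 / real (Suc n))"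
      using K[of a] \<kappa>(1) mult_left_mono[of "conorm a" "max (conorm a) (1 / real (Suc n))" "\<bar>K\<bar> / \<kappa>"] by simp
    then show ?thesis unfolding \<phi>_def using max_pos by (simp only: pos_divide_le_eq)
  qed
  have \<phi>_cont: "continuous_on UNIV (\<phi> n)" for n
    unfolding \<phi>_def using max_pos[THEN less_imp_neq] by (intro continuous_intros \<psi> continuous_conorm) metis
  have \<phi>_C1: "continuous_map (C1_topology A) euclideanreal (\<lambda>f. \<phi> n (covector f))" for n
    using continuous_map_compose[OF continuous_map_covector, of euclideanreal "\<phi> n"] \<phi>_cont by (simp add: comp_def)
  have \<psi>m [measurable]: "\<psi> \<in> borel_measurable borel" by (rule borel_measurable_continuous_onI[OF \<psi>(1)])
  have \<phi>m [measurable]: "\<phi> n \<in> borel_measurable borel" for n by (rule borel_measurable_continuous_onI[OF \<phi>_cont])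
  have lim: "(\<lambda>n. \<integral>f. \<phi> n (covector f) \<partial>weighted_cond A G (rf_cond W) p 0) \<longlonglongrightarrow> (\<integral>a. \<psi> a \<partial>cov_law W)"
    if W: "z_KROK A G P W" for W :: "('w, 'p, 1) random_field"
  proof -
    have "(\<integral>a. \<psi> a \<partial>cov_law W) = (\<integral>f. \<psi> (covector f) \<partial>rf_cond W p 0)"
      unfolding cov_law_def using measurable_rf_cond[OF W covector_measurable] by (intro integral_distr) auto
    moreover have "(\<lambda>n. \<integral>f. conorm (covector f) * \<phi> n (covector f) \<partial>rf_cond W p 0)
        \<longlonglongrightarrow> (\<integral>f. \<psi> (covector f) \<partial>rf_cond W p 0)"
    proof (rule integral_dominated_convergence)
      show "(\<lambda>f. \<psi> (covector f)) \<in> borel_measurable (rf_cond W p 0)"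
        by (rule measurable_rf_cond[OF W]) measurable
      show "(\<lambda>f. conorm (covector f) * \<phi> n (covector f)) \<in> borel_measurable (rf_cond W p 0)" for n
        by (rule measurable_rf_cond[OF W]) measurable
      show "integrable (rf_cond W p 0) (\<lambda>f. conorm (covector f) * (\<bar>K\<bar> / \<kappa>))"
        using integrable_conorm[OF W] by simp
      show "AE f in rf_cond W p 0. norm (conorm (covector f) * \<phi> n (covector f)) \<le> conorm (covector f) * (\<bar>K\<bar> / \<kappa>)" for n
      proof (rule AE_I2)
        fix f
        show "norm (conorm (covector f) * \<phi> n (covector f)) \<le> conorm (covector f) * (\<bar>K\<bar> / \<kappa>)"
          using mult_left_mono[OF \<phi>_bound[of n "covector f"] conorm_nonneg[of "covector f"]]
            \<phi>_nonneg[of n "covector f"] by (simp add: abs_mult)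
      qed
      have "(\<lambda>n. conorm a * \<phi> n a) \<longlonglongrightarrow> \<psi> a" for a
      proof (cases "conorm a = 0")
        case True
        \<comment> \<open>Where the weight vanishes, linear growth makes \<open>\<psi>\<close>
          vanish too, so the weighting loses nothing.\<close>
        then have "\<psi> a = 0" using K[of a] \<psi>(2)[of a] by simp
        then show ?thesis using True by simp
      next
        case False
        then have "conorm a > 0" by (simp add: less_le)
        then obtain m where m: "1 / real (Suc m) < conorm a" using nat_approx_posE by blast
        have "eventually (\<lambda>n. conorm a * \<phi> n a = \<psi> a) sequentially"
        proof (rule eventually_sequentiallyI[of m])
          fix n assume "m \<le> n"
          then have "1 / real (Suc n) \<le> 1 / real (Suc m)" by (intro divide_left_mono) auto
          then have "max (conorm a) (1 / real (Suc n)) = conorm a" using m by simp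
          then show "conorm a * \<phi> n a = \<psi> a" using False by (simp add: \<phi>_def)
        qed
        then show ?thesis by (rule tendsto_eventually)
      qed
      then show "AE f in rf_cond W p 0. (\<lambda>n. conorm (covector f) * \<phi> n (covector f)) \<longlonglongrightarrow> \<psi> (covector f)"
        by simp
    qed
    moreover have "(\<integral>f. \<phi> n (covector f) \<partial>weighted_cond A G (rf_cond W) p 0)
        = (\<integral>f. conorm (covector f) * \<phi> n (covector f) \<partial>rf_cond W p 0)" for n
      by (rule weighted_cond_integral[OF W]) measurable
    ultimately show ?thesis by simp
  qed
  have "(\<integral>f. \<phi> n (covector f) \<partial>weighted_cond A G (rf_cond X') p 0)
      = (\<integral>f. \<phi> n (covector f) \<partial>weighted_cond A G (rf_cond X) p 0)" for n
  proof (rule weighted_cond_eq[OF \<phi>_C1 _ \<phi>_nonneg dens])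
    show "bounded (range (\<lambda>f. \<phi> n (covector f)))"
      using \<phi>_nonneg \<phi>_bound by (intro boundedI[of _ "\<bar>K\<bar> / \<kappa>"]) auto
  qed
  then show ?thesis using LIMSEQ_unique[OF lim[OF X]] lim[OF X'] by simp
qed

text \<open>By Fubini slot \<open>b\<close> can be integrated first. For fixed other rows the
  absolute determinant is continuous and of linear growth in that row.\<close>

lemma mixed_integral_cov_law_eq:
  fixes \<nu> :: "'m \<Rightarrow> (real^'m) measure"
  assumes \<nu>: "\<And>i. prob_space (\<nu> i)" "\<And>i. sets (\<nu> i) = sets borel" "\<And>i. integrable (\<nu> i) norm"
    and dens: "rf_dens X p 0 \<noteq> 0"
  shows "mixed_integral (\<nu>(b := cov_law X')) = mixed_integral (\<nu>(b := cov_law X))"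
proof -
  let ?I = "UNIV - {b}"
  define r where "r = (\<lambda>(k :: 'm \<Rightarrow> real^'m) a. \<bar>rowdet (k(b := a))\<bar>)"
  have iter: "mixed_integral (\<nu>(b := cov_law W)) = (\<integral>k. (\<integral>a. r k a \<partial>cov_law W) \<partial>PiM ?I \<nu>)"
    if W: "z_KROK A G P W" for W :: "('w, 'p, 1) random_field"
  proof -
    define \<nu>' where "\<nu>' = \<nu>(b := cov_law W)"
    have \<nu>': "\<And>i. prob_space (\<nu>' i)" "\<And>i. sets (\<nu>' i) = sets borel" "\<And>i. integrable (\<nu>' i) norm"
      using \<nu> cov_law_prob[OF W] cov_law_sets[OF W] cov_law_integrable[OF W] by (auto simp: \<nu>'_def)
    interpret product_prob_space \<nu>' by (rule product_prob_spaceI) (rule \<nu>')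
    have "mixed_integral \<nu>' = (\<integral>k. \<bar>rowdet k\<bar> \<partial>PiM (insert b ?I) \<nu>')"
      by (simp add: mixed_integral_def insert_UNIV)
    also have "\<dots> = (\<integral>k. (\<integral>a. r k a \<partial>\<nu>' b) \<partial>PiM ?I \<nu>')"
      unfolding r_def using integrable_rowdet[OF \<nu>'] by (intro product_integral_insert) (auto simp: insert_UNIV)
    also have "PiM ?I \<nu>' = PiM ?I \<nu>" by (rule PiM_cong) (auto simp: \<nu>'_def)
    finally show ?thesis unfolding \<nu>'_def by (simp only: fun_upd_same)
  qed
  have "(\<integral>a. r k a \<partial>cov_law X') = (\<integral>a. r k a \<partial>cov_law X)" for k :: "'m \<Rightarrow> real^'m"
  proof (rule cov_law_integral_eq[OF _ _ _ dens])
    show "continuous_on UNIV (r k)" unfolding r_def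
      using linear_continuous_on[of "\<lambda>a. rowdet (k(b := a))"] linear_rowdet[of k b]
      by (intro continuous_intros) (simp add: linear_conv_bounded_linear)
    show "r k a \<le> (fact (CARD('m)) * (\<Prod>i\<in>?I. norm (k i))) * norm a" for a
    proof -
      have "(\<Prod>i\<in>UNIV. norm ((k(b := a)) i)) = norm a * (\<Prod>i\<in>?I. norm ((k(b := a)) i))"
        by (subst prod.remove[of UNIV b]) auto
      also have "(\<Prod>i\<in>?I. norm ((k(b := a)) i)) = (\<Prod>i\<in>?I. norm (k i))"
        by (intro prod.cong) auto
      finally show ?thesis using abs_rowdet_le[of "k(b := a)"] by (simp add: r_def mult_ac)
    qed
  qed (simp add: r_def)
  then show ?thesis by (simp add: iter[OF X] iter[OF X'])
qed

end

end

section \<open>The inequality\<close>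

lemma nth_at_two:
  fixes Ys :: "'a list"
  assumes a: "to_nat_on (UNIV :: 'm::finite set) a = 0" and b: "to_nat_on (UNIV :: 'm set) b = 1"
  shows "nth_at ([U, W] @ Ys) = (nth_at ([U', W'] @ Ys))(a := U, b := W)"
proof
  fix i :: 'm
  have inj: "inj (to_nat_on (UNIV :: 'm set))" using to_nat_on_finite[of "UNIV :: 'm set"] by (simp add: bij_betw_def)
  show "nth_at ([U, W] @ Ys) i = ((nth_at ([U', W'] @ Ys))(a := U, b := W)) i"
  proof (cases "i = a \<or> i = b")
    case True
    then show ?thesis using a b by (auto simp: nth_at_def)
  next
    case False
    then have "to_nat_on (UNIV :: 'm set) i \<noteq> 0" "to_nat_on (UNIV :: 'm set) i \<noteq> Suc 0"
      using a b injD[OF inj, of i a] injD[OF inj, of i b] by auto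
    then obtain n where "to_nat_on (UNIV :: 'm set) i = Suc (Suc n)" by (metis not0_implies_Suc)
    then show ?thesis using False by (simp add: nth_at_def)
  qed
qed

theorem theorem4:
  fixes A :: "('p::{t2_space,second_countable_topology}, 'm::finite) chart set"
    and G :: "('p, 'm) chart \<Rightarrow> 'p \<Rightarrow> real^'m^'m"
    and P :: "'w measure"
    and X1 X1' X2 X2' :: "('w, 'p, 1) random_field"
    and Ys :: "('w, 'p, 1) random_field list"
    and p :: 'p
  assumes "riemannian_manifold A G"
    and "CARD('m) \<ge> 2"
    and "prob_space P"
    and "length Ys = CARD('m) - 2"
    and "\<forall>W \<in> set (Ys @ [X1, X1', X2, X2']). z_KROK A G P W"
    and "prob_space.indep_vars P (\<lambda>_. C1_borel A)
           (\<lambda>i. rf_map ((Ys @ [X1, X1', X2, X2']) ! i)) {..<CARD('m) + 2}"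
    and "distr P (C1_borel A) (rf_map X1') = distr P (C1_borel A) (rf_map X1)"
    and "distr P (C1_borel A) (rf_map X2') = distr P (C1_borel A) (rf_map X2)"
  shows "vol_density_inter A G ([X1, X2] @ Ys) p
         \<ge> sqrt (vol_density_inter A G ([X1, X1'] @ Ys) p * vol_density_inter A G ([X2, X2'] @ Ys) p)"
proof -
  interpret riemannian_point A G p by unfold_locales (rule assms(1))
  let ?e = "to_nat_on (UNIV :: 'm set)"
  have bij: "bij_betw ?e UNIV {..<CARD('m)}" by (rule to_nat_on_finite) simp
  then have img: "range ?e = {..<CARD('m)}" by (simp add: bij_betw_def)
  \<comment> \<open>The lists start with the two special fields, so their slots are those numbered 0
    and 1; both exist in dimension at least 2.\<close>
  have "0 \<in> range ?e" "1 \<in> range ?e" unfolding img using assms(2) by auto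
  then obtain a b where ab: "?e a = 0" "?e b = 1" by (metis imageE)
  then have "a \<noteq> b" by auto
  define F :: "'m \<Rightarrow> ('w, 'p, 1) random_field" where "F = nth_at ([X1, X2] @ Ys)"
  define \<nu> where "\<nu> = (\<lambda>i. cov_law (F i))"
  define MI where "MI = (\<lambda>\<alpha> \<beta>. mixed_integral (\<nu>(a := \<alpha>, b := \<beta>)))"
  define \<rho> where "\<rho> = (\<lambda>W :: ('w, 'p, 1) random_field. rf_dens W p 0)"
  define R where "R = (\<Prod>i\<in>UNIV - {a} - {b}. \<rho> (F i))"
  note Xs = assms(5)
  have K: "z_KROK A G P X1" "z_KROK A G P X1'" "z_KROK A G P X2" "z_KROK A G P X2'"
    using Xs by auto
  have KF: "z_KROK A G P (F i)" for i
  proof -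
    have "?e i < CARD('m)" using rangeI[of ?e i] unfolding img by simp
    then have "?e i < length ([X1, X2] @ Ys)" using assms(2,4) by simp
    then have "F i \<in> set ([X1, X2] @ Ys)" unfolding F_def nth_at_def by (rule nth_mem)
    then show ?thesis using Xs by auto
  qed
  have \<nu>: "prob_space (\<nu> i)" "sets (\<nu> i) = sets borel" "integrable (\<nu> i) norm" for i
    unfolding \<nu>_def by (fact cov_law_prob[OF KF] cov_law_sets[OF KF] cov_law_integrable[OF KF])+
  have \<rho>_nonneg: "0 \<le> \<rho> W" if "z_KROK A G P W" for W
    using that by (simp add: \<rho>_def z_KROK_def)
  \<comment> \<open>The three densities share the factors coming from \<open>Ys\<close> and differ
    only in the slots \<open>a\<close> and \<open>b\<close>.\<close>
  have \<delta>: "vol_density_inter A G ([U, W] @ Ys) p = sqrt (det H) * MI (cov_law U) (cov_law W) * (\<rho> U * \<rho> W * R)"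
    if U: "z_KROK A G P U" and W: "z_KROK A G P W" for U W
  proof -
    have upd: "nth_at ([U, W] @ Ys) = F(a := U, b := W)"
      unfolding F_def by (rule nth_at_two[OF ab])
    have "vol_density_inter A G ([U, W] @ Ys) p = sqrt (det H) * mixed_integral (\<lambda>i :: 'm. cov_law (nth_at ([U, W] @ Ys) i))
        * (\<Prod>i\<in>(UNIV :: 'm set). \<rho> (nth_at ([U, W] @ Ys) i))"
      unfolding \<rho>_def by (rule vol_density_inter_eq[of P]) (unfold upd, use U W KF in auto)
    also have "(\<lambda>i :: 'm. cov_law (nth_at ([U, W] @ Ys) i)) = \<nu>(a := cov_law U, b := cov_law W)"
      unfolding upd \<nu>_def by (auto simp: fun_eq_iff)
    also have "(\<Prod>i\<in>(UNIV :: 'm set). \<rho> (nth_at ([U, W] @ Ys) i)) = \<rho> U * (\<rho> W * R)"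
    proof -
      have "(\<Prod>i\<in>UNIV. \<rho> ((F(a := U, b := W)) i))
          = \<rho> U * (\<rho> W * (\<Prod>i\<in>UNIV - {a} - {b}. \<rho> ((F(a := U, b := W)) i)))"
        using \<open>a \<noteq> b\<close> by (simp add: prod.remove[of UNIV a] prod.remove[of "UNIV - {a}" b])
      also have "(\<Prod>i\<in>UNIV - {a} - {b}. \<rho> ((F(a := U, b := W)) i)) = R"
        unfolding R_def by (intro prod.cong) auto
      finally show ?thesis by (simp only: upd)
    qed
    finally show ?thesis unfolding MI_def by (simp only: mult.assoc)
  qed
  have R_nonneg: "0 \<le> R" unfolding R_def using \<rho>_nonneg KF by (intro prod_nonneg) auto
  have MI_nonneg: "0 \<le> MI \<alpha> \<beta>" for \<alpha> \<beta> unfolding MI_def mixed_integral_def by simp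
  have nonneg: "0 \<le> vol_density_inter A G ([X1, X2] @ Ys) p"
    unfolding \<delta>[OF K(1,3)] using R_nonneg MI_nonneg det_H_nonneg \<rho>_nonneg K by simp
  have same: "MI (cov_law X) (cov_law X') = MI (cov_law X) (cov_law X) \<and> \<rho> X' = \<rho> X"
    if X: "z_KROK A G P X" "z_KROK A G P X'" and law: "distr P (C1_borel A) (rf_map X') = distr P (C1_borel A) (rf_map X)"
      and "\<rho> X \<noteq> 0" for X X' :: "('w, 'p, 1) random_field"
  proof
    show "\<rho> X' = \<rho> X" unfolding \<rho>_def by (rule dens_eq[OF assms(3) X law])
    show "MI (cov_law X) (cov_law X') = MI (cov_law X) (cov_law X)"
      unfolding MI_def
      by (rule mixed_integral_cov_law_eq[OF assms(3) X law])
        (use \<open>\<rho> X \<noteq> 0\<close> \<nu> cov_law_prob[OF X(1)] cov_law_sets[OF X(1)] cov_law_integrable[OF X(1)] in \<open>auto simp: \<rho>_def\<close>)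
  qed
  show ?thesis
  proof (cases "\<rho> X1 = 0 \<or> \<rho> X2 = 0")
    case True
    then have "vol_density_inter A G ([X1, X1'] @ Ys) p * vol_density_inter A G ([X2, X2'] @ Ys) p = 0"
      unfolding \<delta>[OF K(1,2)] \<delta>[OF K(3,4)] by auto
    then show ?thesis using nonneg by (simp only: real_sqrt_zero)
  next
    case False
    \<comment> \<open>After each primed field is replaced by its unprimed copy, the product under
      the root and the square of the left-hand density contain the same factor
      \<open>?c\<close>.\<close>
    let ?\<alpha> = "cov_law X1" and ?\<beta> = "cov_law X2" and ?c = "(sqrt (det H) * \<rho> X1 * \<rho> X2 * R)\<^sup>2"
    have "MI ?\<alpha> ?\<alpha> * MI ?\<beta> ?\<beta> \<le> (MI ?\<alpha> ?\<beta>)\<^sup>2"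
      unfolding MI_def
      by (rule mixed_integral_hyperbolic[OF \<open>a \<noteq> b\<close> \<nu>
          cov_law_prob[OF K(1)] cov_law_sets[OF K(1)] cov_law_integrable[OF K(1)]
          cov_law_prob[OF K(3)] cov_law_sets[OF K(3)] cov_law_integrable[OF K(3)]])
    then have "?c * (MI ?\<alpha> ?\<alpha> * MI ?\<beta> ?\<beta>) \<le> ?c * (MI ?\<alpha> ?\<beta>)\<^sup>2"
      by (rule mult_left_mono) simp
    moreover have "vol_density_inter A G ([X1, X1'] @ Ys) p * vol_density_inter A G ([X2, X2'] @ Ys) p
        = ?c * (MI ?\<alpha> ?\<alpha> * MI ?\<beta> ?\<beta>)"
      using same[OF K(1,2) assms(7)] same[OF K(3,4) assms(8)] False
      unfolding \<delta>[OF K(1,2)] \<delta>[OF K(3,4)] by (simp add: power2_eq_square mult_ac)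
    moreover have "(vol_density_inter A G ([X1, X2] @ Ys) p)\<^sup>2 = ?c * (MI ?\<alpha> ?\<beta>)\<^sup>2"
      unfolding \<delta>[OF K(1,3)] by (simp add: power2_eq_square mult_ac)
    ultimately show ?thesis using nonneg by (intro real_le_lsqrt) (simp_all only:)
  qed
qed

end
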